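(* Let $\mathbb{k}$ be an algebraically closed field of characteristic $0$. For $(\xi_1,\xi_2,\alpha_1,\alpha_2,\lambda)\in\mathbb{k}^5$ set $$m_0=1,\qquad m_i=\lambda(\xi_1^i+i\alpha_1\xi_1^{i-1})+(1-\lambda)(\xi_2^i+i\alpha_2\xi_2^{i-1})\quad (i\ge 1),$$ and consider the moment map $\mathbb{k}^5\to\mathbb{P}^d$, $(\xi_1,\xi_2,\alpha_1,\alpha_2,\lambda)\mapsto[m_0:m_1:\cdots:m_d]$. Up to the exchange of the two mixture components, this map is generically four-to-one (in particular generically finite-to-one) for $d=5$, and generically one-to-one for $d=6$.
   Context: Exchange of the two mixture components is the involution $(\xi_1,\xi_2,\alpha_1,\alpha_2,\lambda)\mapsto(\xi_2,\xi_1,\alpha_2,\alpha_1,1-\lambda)$, which does not change the moments. "Generically $n$-to-one up to exchange" means that the fiber over a generic point of the image consists of exactly $n$ orbits of this involution. *)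

theory Defs
  imports
    "HOL-Library.Poly_Mapping"
    "HOL-Computational_Algebra.Polynomial"
begin

section \<open>Projective space and its Zariski topology\<close>

text \<open>
  A point of \<open>\<P>\<^sup>d\<close> is a class of nonzero coordinate vectors \<open>(v\<^sub>0, \<dots>, v\<^sub>d)\<close> up to nonzero
  scalars. Coordinate vectors are functions on the naturals that are zero beyond index \<open>d\<close>,
  so that distinct classes are distinct points.
\<close>

type_synonym 'a proj_point = "(nat \<Rightarrow> 'a) set"

definition proj_class :: "(nat \<Rightarrow> 'a::field) \<Rightarrow> 'a proj_point" where
  "proj_class v = {w. \<exists>c. c \<noteq> 0 \<and> w = (\<lambda>i. c * v i)}"

definition hom_coords :: "nat \<Rightarrow> (nat \<Rightarrow> 'a::field) set" where
  "hom_coords d = {v. (\<exists>i. v i \<noteq> 0) \<and> (\<forall>i>d. v i = 0)}"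

definition proj_space :: "nat \<Rightarrow> 'a::field proj_point set" where
  "proj_space d = proj_class ` hom_coords d"

text \<open>
  Polynomials in countably many variables: an exponent vector is a finitely supported map
  from variable indices to exponents, and a polynomial is a finitely supported map from
  exponent vectors to coefficients.
\<close>

type_synonym 'a mpoly = "(nat \<Rightarrow>\<^sub>0 nat) \<Rightarrow>\<^sub>0 'a"

definition poly_eval :: "'a::field mpoly \<Rightarrow> (nat \<Rightarrow> 'a) \<Rightarrow> 'a" where
  "poly_eval F v =
     (\<Sum>e\<in>Poly_Mapping.keys F. Poly_Mapping.lookup F e *
        (\<Prod>i\<in>Poly_Mapping.keys e. v i ^ Poly_Mapping.lookup e i))"

definition homogeneous_form :: "nat \<Rightarrow> 'a::field mpoly \<Rightarrow> bool" where
  "homogeneous_form d F \<longleftrightarrow>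
     (\<exists>n. \<forall>e\<in>Poly_Mapping.keys F.
        Poly_Mapping.keys e \<subseteq> {..d} \<and>
        (\<Sum>i\<in>Poly_Mapping.keys e. Poly_Mapping.lookup e i) = n)"

definition zariski_closed :: "nat \<Rightarrow> 'a::field proj_point set \<Rightarrow> bool" where
  "zariski_closed d Z \<longleftrightarrow>
     (\<exists>S. (\<forall>F\<in>S. homogeneous_form d F) \<and>
          Z = {p \<in> proj_space d. \<forall>F\<in>S. \<forall>v\<in>p. poly_eval F v = 0})"

definition zariski_closure :: "nat \<Rightarrow> 'a::field proj_point set \<Rightarrow> 'a proj_point set" where
  "zariski_closure d A = \<Inter>{Z. zariski_closed d Z \<and> A \<subseteq> Z}"

text \<open>
  A property holds at a generic point of \<open>A\<close> if it holds on a relatively open dense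
  subset of \<open>A\<close>; the relatively open subsets are the sets \<open>A - Z\<close> with \<open>Z\<close> closed.
\<close>

definition generically_on ::
    "nat \<Rightarrow> 'a::field proj_point set \<Rightarrow> ('a proj_point \<Rightarrow> bool) \<Rightarrow> bool" where
  "generically_on d A P \<longleftrightarrow>
     (\<exists>Z. zariski_closed d Z \<and> A \<subseteq> zariski_closure d (A - Z) \<and> (\<forall>p\<in>A - Z. P p))"

section \<open>The moment map\<close>

text \<open>The components are, in this order, \<open>\<xi>\<^sub>1, \<xi>\<^sub>2, \<alpha>\<^sub>1, \<alpha>\<^sub>2, \<lambda>\<close>.\<close>

type_synonym 'a params = "'a \<times> 'a \<times> 'a \<times> 'a \<times> 'a"

fun moment :: "'a::field params \<Rightarrow> nat \<Rightarrow> 'a" where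
  "moment (\<xi>1, \<xi>2, \<alpha>1, \<alpha>2, l) i =
     (if i = 0 then 1
      else l * (\<xi>1 ^ i + of_nat i * \<alpha>1 * \<xi>1 ^ (i - 1))
         + (1 - l) * (\<xi>2 ^ i + of_nat i * \<alpha>2 * \<xi>2 ^ (i - 1)))"

definition moment_map :: "nat \<Rightarrow> 'a::field params \<Rightarrow> 'a proj_point" where
  "moment_map d x = proj_class (\<lambda>i. if i \<le> d then moment x i else 0)"

fun exchange :: "'a::field params \<Rightarrow> 'a params" where
  "exchange (\<xi>1, \<xi>2, \<alpha>1, \<alpha>2, l) = (\<xi>2, \<xi>1, \<alpha>2, \<alpha>1, 1 - l)"

lemma exchange_exchange: "exchange (exchange x) = x"
  by (cases x) simp

lemma moment_exchange: "moment (exchange x) i = moment x i"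
  by (cases x) simp

lemma moment_map_in_proj_space: "moment_map d x \<in> proj_space d"
proof -
  have "moment x 0 \<noteq> 0"
    by (cases x) simp
  then show ?thesis
    by (auto simp: moment_map_def proj_space_def hom_coords_def intro!: imageI exI[of _ 0])
qed

section \<open>Generic cardinality of the fibers\<close>

definition exchange_orbits :: "'a::field params set \<Rightarrow> 'a params set set" where
  "exchange_orbits A = (\<lambda>x. {x, exchange x}) ` A"

definition generically_to_one_up_to_exchange ::
    "nat \<Rightarrow> ('a::field params \<Rightarrow> 'a proj_point) \<Rightarrow> nat \<Rightarrow> bool" where
  "generically_to_one_up_to_exchange d f n \<longleftrightarrow>
     generically_on d (range f)
       (\<lambda>p. finite (exchange_orbits (f -` {p})) \<and> card (exchange_orbits (f -` {p})) = n)"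

definition generically_finite_to_one ::
    "nat \<Rightarrow> ('a::field params \<Rightarrow> 'a proj_point) \<Rightarrow> bool" where
  "generically_finite_to_one d f \<longleftrightarrow> generically_on d (range f) (\<lambda>p. finite (f -` {p}))"

end

theory Submission
  imports Defs "Jordan_Normal_Form.Determinant"
begin

text \<open>
  The moments of a mixture are the values at \<open>1, x, x\<^sup>2, \<dots>\<close> of a linear functional supported on
  two double points, the nodes \<open>\<xi>\<^sub>1\<close> and \<open>\<xi>\<^sub>2\<close>. With \<open>e = \<xi>\<^sub>1 + \<xi>\<^sub>2\<close> and \<open>f = \<xi>\<^sub>1 \<xi>\<^sub>2\<close>, this functional
  kills all multiples of \<open>(x\<^sup>2 - e x + f)\<^sup>2\<close>. For given moments \<open>m\<^sub>0 = 1, m\<^sub>1, \<dots>, m\<^sub>d\<close> this amounts to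
  \<open>d - 3\<close> conics in the \<open>(e, f)\<close>-plane (lemma \<open>conic_moment\<close>). Conversely a common point \<open>(e, f)\<close> of
  the conics determines the two nodes up to order. If they are distinct, Hermite interpolation
  recovers the weights and, if the weights are nonzero, the slopes
  (\<open>moments_determine_components\<close>, \<open>components_exist\<close>). So generically the exchange orbits in a fiber
  are the common points of the conics.

  For \<open>d = 5\<close> there are two conics, which meet in four points. Concretely, a combination of
  the two is linear in \<open>f\<close>, and eliminating \<open>f\<close> leaves a quartic in \<open>e\<close>, the \<open>eliminant\<close>. The
  fiber has exactly four orbits when the eliminant has degree four and shares no root with
  the product \<open>degeneracy\<close> of its derivative and of the expressions detecting equal nodes,
  zero weights and an undetermined \<open>f\<close> (\<open>card_exchange_orbits_fiber\<close>).

  For \<open>d = 6\<close> the third conic singles out one of the four points: eliminating \<open>f\<close> from all three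
  conics gives a cubic and a quadratic in \<open>e\<close>, and these have at most one common root unless
  the polynomial \<open>separator\<close> in the moments vanishes (\<open>fiber6_node_sum_eq\<close>).

  It remains to see that these conditions hold generically. Absence of a common root is
  the nonvanishing of a Sylvester determinant, so all conditions say that some form in the
  moments is nonzero. Because the parameter space is an affine space, such a form defines a dense
  open subset of the image as soon as it is nonzero at one point
  (\<open>generically_on_range_moment_map\<close>), and one explicit rational mixture serves for both cases.
\<close>

section \<open>Forms as functions\<close>

definition monomial_eval :: "(nat \<Rightarrow>\<^sub>0 nat) \<Rightarrow> (nat \<Rightarrow> 'a::field) \<Rightarrow> 'a" where
  "monomial_eval e v = (\<Prod>i\<in>Poly_Mapping.keys e. v i ^ Poly_Mapping.lookup e i)"

definition total_degree :: "(nat \<Rightarrow>\<^sub>0 nat) \<Rightarrow> nat" where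
  "total_degree e = (\<Sum>i\<in>Poly_Mapping.keys e. Poly_Mapping.lookup e i)"

lemma monomial_eval_superset:
  assumes "finite K" "Poly_Mapping.keys e \<subseteq> K"
  shows "monomial_eval e v = (\<Prod>i\<in>K. v i ^ Poly_Mapping.lookup e i)"
  unfolding monomial_eval_def
  by (rule prod.mono_neutral_left) (use assms in \<open>auto simp: in_keys_iff\<close>)

lemma total_degree_superset:
  assumes "finite K" "Poly_Mapping.keys e \<subseteq> K"
  shows "total_degree e = (\<Sum>i\<in>K. Poly_Mapping.lookup e i)"
  unfolding total_degree_def
  by (rule sum.mono_neutral_left) (use assms in \<open>auto simp: in_keys_iff\<close>)

lemma monomial_eval_add: "monomial_eval (a + b) v = monomial_eval a v * monomial_eval b v"
proof -
  let ?K = "Poly_Mapping.keys a \<union> Poly_Mapping.keys b"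
  have "Poly_Mapping.keys (a + b) \<subseteq> ?K"
    by (rule keys_add)
  then show ?thesis
    by (simp add: monomial_eval_superset[of ?K] lookup_add power_add prod.distrib)
qed

lemma total_degree_add: "total_degree (a + b) = total_degree a + total_degree b"
proof -
  let ?K = "Poly_Mapping.keys a \<union> Poly_Mapping.keys b"
  have "Poly_Mapping.keys (a + b) \<subseteq> ?K"
    by (rule keys_add)
  then show ?thesis
    by (simp add: total_degree_superset[of ?K] lookup_add sum.distrib)
qed

lemma poly_eval_monomial_eval:
  "poly_eval F v = (\<Sum>e\<in>Poly_Mapping.keys F. Poly_Mapping.lookup F e * monomial_eval e v)"
  by (simp add: poly_eval_def monomial_eval_def)

lemma poly_eval_add: "poly_eval (F + G) v = poly_eval F v + poly_eval G v"
  unfolding poly_eval_monomial_eval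
  by (rule setsum_keys_plus_distrib) (simp_all add: distrib_right)

lemma poly_eval_zero [simp]: "poly_eval 0 v = 0"
  by (simp add: poly_eval_def)

lemma poly_eval_sum: "poly_eval (sum f A) v = (\<Sum>a\<in>A. poly_eval (f a) v)"
  by (induction A rule: infinite_finite_induct) (simp_all add: poly_eval_add)

lemma poly_eval_single: "poly_eval (Poly_Mapping.single e c) v = c * monomial_eval e v"
  by (cases "c = 0") (simp_all add: poly_eval_monomial_eval)

lemma poly_mapping_sum_singles:
  "F = (\<Sum>e\<in>Poly_Mapping.keys F. Poly_Mapping.single e (Poly_Mapping.lookup F e))"
proof (rule poly_mapping_eqI)
  fix k
  have "(\<Sum>e\<in>Poly_Mapping.keys F. Poly_Mapping.lookup F e when e = k) = Poly_Mapping.lookup F k"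
    by (simp add: when_def in_keys_iff)
  then show "Poly_Mapping.lookup F k
      = Poly_Mapping.lookup (\<Sum>e\<in>Poly_Mapping.keys F. Poly_Mapping.single e (Poly_Mapping.lookup F e)) k"
    by (simp add: lookup_sum lookup_single)
qed

lemma poly_eval_mult: "poly_eval (F * G) v = poly_eval F v * poly_eval G v"
proof -
  have "F * G = (\<Sum>a\<in>Poly_Mapping.keys F. \<Sum>b\<in>Poly_Mapping.keys G.
      Poly_Mapping.single (a + b) (Poly_Mapping.lookup F a * Poly_Mapping.lookup G b))"
    by (subst (1) poly_mapping_sum_singles[of F], subst (1) poly_mapping_sum_singles[of G])
      (simp add: sum_product mult_single)
  then have "poly_eval (F * G) v = (\<Sum>a\<in>Poly_Mapping.keys F. \<Sum>b\<in>Poly_Mapping.keys G.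
      Poly_Mapping.lookup F a * Poly_Mapping.lookup G b * (monomial_eval a v * monomial_eval b v))"
    by (simp only: poly_eval_sum poly_eval_single monomial_eval_add)
  also have "\<dots> = poly_eval F v * poly_eval G v"
    unfolding poly_eval_monomial_eval sum_product by (intro sum.cong refl) (simp only: mult_ac)
  finally show ?thesis .
qed

text \<open>
  The zero form counts as a form of every degree, as it does for \<^const>\<open>homogeneous_form\<close>.
\<close>

definition form_of_degree :: "nat \<Rightarrow> nat \<Rightarrow> 'a::field mpoly \<Rightarrow> bool" where
  "form_of_degree d n F \<longleftrightarrow>
     (\<forall>e\<in>Poly_Mapping.keys F. Poly_Mapping.keys e \<subseteq> {..d} \<and> total_degree e = n)"

lemma homogeneous_form_iff: "homogeneous_form d F \<longleftrightarrow> (\<exists>n. form_of_degree d n F)"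
  by (simp add: homogeneous_form_def form_of_degree_def total_degree_def)

lemma form_of_degree_add:
  "form_of_degree d n F \<Longrightarrow> form_of_degree d n G \<Longrightarrow> form_of_degree d n (F + G)"
  unfolding form_of_degree_def using keys_add[of F G] by blast

lemma form_of_degree_mult:
  assumes "form_of_degree d m F" "form_of_degree d n G"
  shows "form_of_degree d (m + n) (F * G)"
  unfolding form_of_degree_def
proof
  fix e assume "e \<in> Poly_Mapping.keys (F * G)"
  then obtain a b where e: "e = a + b" "a \<in> Poly_Mapping.keys F" "b \<in> Poly_Mapping.keys G"
    using keys_mult[of F G] by blast
  moreover have "Poly_Mapping.keys e \<subseteq> Poly_Mapping.keys a \<union> Poly_Mapping.keys b"
    unfolding e by (rule keys_add)
  ultimately show "Poly_Mapping.keys e \<subseteq> {..d} \<and> total_degree e = m + n"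
    using assms unfolding form_of_degree_def by (fastforce simp: total_degree_add)
qed

lemma form_of_degree_const: "form_of_degree d 0 (Poly_Mapping.single 0 c)"
  by (cases "c = 0") (simp_all add: form_of_degree_def total_degree_def)

lemma form_of_degree_var:
  "i \<le> d \<Longrightarrow> form_of_degree d n (Poly_Mapping.single (Poly_Mapping.single i n) 1)"
  by (cases "n = 0") (simp_all add: form_of_degree_def total_degree_def)

lemma poly_eval_const: "poly_eval (Poly_Mapping.single 0 c) v = c"
  by (simp add: poly_eval_single monomial_eval_def)

lemma poly_eval_var:
  "poly_eval (Poly_Mapping.single (Poly_Mapping.single i n) 1) v = v i ^ n"
  by (cases "n = 0") (simp_all add: poly_eval_single monomial_eval_def del: single_one)

lemma form_eval_scale:
  assumes "form_of_degree d n F"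
  shows "poly_eval F (\<lambda>i. c * v i) = c ^ n * poly_eval F v"
proof -
  have "monomial_eval e (\<lambda>i. c * v i) = c ^ n * monomial_eval e v"
    if "e \<in> Poly_Mapping.keys F" for e
  proof -
    have "total_degree e = n"
      using assms that by (simp add: form_of_degree_def)
    then show ?thesis
      unfolding monomial_eval_def total_degree_def
      by (simp add: power_mult_distrib prod.distrib flip: power_sum)
  qed
  then show ?thesis
    by (simp add: poly_eval_monomial_eval sum_distrib_left mult_ac)
qed

text \<open>
  The points of the image have a representative with \<open>v\<^sub>0 = 1\<close>. On the chart \<open>v\<^sub>0 = 1\<close> forms
  restrict to arbitrary polynomials in \<open>v\<^sub>1, \<dots>, v\<^sub>d\<close>, so that all genericity conditions can be stated
  as inhomogeneous expressions.
\<close>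

definition regular :: "nat \<Rightarrow> ((nat \<Rightarrow> 'a::field) \<Rightarrow> 'a) \<Rightarrow> bool" where
  "regular d \<phi> \<longleftrightarrow> (\<exists>F. homogeneous_form d F \<and> (\<forall>v. v 0 = 1 \<longrightarrow> poly_eval F v = \<phi> v))"

named_theorems regular_intros

lemma regular_const [regular_intros]: "regular d (\<lambda>v. c)"
  unfolding regular_def homogeneous_form_iff
  using form_of_degree_const poly_eval_const by blast

lemma regular_var [regular_intros]: "i \<le> d \<Longrightarrow> regular d (\<lambda>v. v i)"
  unfolding regular_def homogeneous_form_iff
  by (intro exI[of _ "Poly_Mapping.single (Poly_Mapping.single i 1) 1"] conjI exI[of _ 1]
      form_of_degree_var) (simp_all add: poly_eval_var del: single_one)

lemma regular_mult [regular_intros]: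
  assumes "regular d \<phi>" "regular d \<psi>"
  shows "regular d (\<lambda>v. \<phi> v * \<psi> v)"
proof -
  obtain F m G n where "form_of_degree d m F" "form_of_degree d n G"
    and "\<And>v. v 0 = 1 \<Longrightarrow> poly_eval F v = \<phi> v" "\<And>v. v 0 = 1 \<Longrightarrow> poly_eval G v = \<psi> v"
    using assms unfolding regular_def homogeneous_form_iff by metis
  then show ?thesis
    unfolding regular_def homogeneous_form_iff
    by (intro exI[of _ "F * G"]) (auto intro: form_of_degree_mult simp: poly_eval_mult)
qed

text \<open>
  Forms of different degrees become summands of one form after multiplication with powers of
  the coordinate \<open>v\<^sub>0\<close>, whose value on the chart is \<open>1\<close>.
\<close>

lemma regular_add [regular_intros]:
  assumes "regular d \<phi>" "regular d \<psi>"
  shows "regular d (\<lambda>v. \<phi> v + \<psi> v)"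
proof -
  obtain F m G n where F: "form_of_degree d m F" and G: "form_of_degree d n G"
    and ev: "\<And>v. v 0 = 1 \<Longrightarrow> poly_eval F v = \<phi> v" "\<And>v. v 0 = 1 \<Longrightarrow> poly_eval G v = \<psi> v"
    using assms unfolding regular_def homogeneous_form_iff by metis
  define X where "X k = (Poly_Mapping.single (Poly_Mapping.single 0 k) 1 :: 'a mpoly)" for k
  have X: "form_of_degree d k (X k)" for k
    unfolding X_def by (rule form_of_degree_var) simp
  have evX: "poly_eval (X k) v = v 0 ^ k" for k v
    unfolding X_def by (rule poly_eval_var)
  have "form_of_degree d (m + n) (F * X n + X m * G)"
    by (intro form_of_degree_add form_of_degree_mult F G X)
  then show ?thesis
    unfolding regular_def homogeneous_form_iff
    by (intro exI[of _ "F * X n + X m * G"]) (auto simp: poly_eval_add poly_eval_mult evX ev)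
qed

lemma regular_uminus [regular_intros]:
  assumes "regular d \<phi>" shows "regular d (\<lambda>v. - \<phi> v)"
  using regular_mult[OF regular_const[of d "-1"] assms] by simp

lemma regular_diff [regular_intros]:
  assumes "regular d \<phi>" "regular d \<psi>" shows "regular d (\<lambda>v. \<phi> v - \<psi> v)"
  using regular_add[OF assms(1) regular_uminus[OF assms(2)]] by simp

lemma regular_power [regular_intros]:
  assumes "regular d \<phi>" shows "regular d (\<lambda>v. \<phi> v ^ k)"
  by (induction k) (simp_all add: regular_const regular_mult assms)

lemma regular_sum:
  assumes "\<And>a. a \<in> A \<Longrightarrow> regular d (\<phi> a)" shows "regular d (\<lambda>v. \<Sum>a\<in>A. \<phi> a v)"
  using assms by (induction A rule: infinite_finite_induct) (simp_all add: regular_const regular_add)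

lemma regular_prod:
  assumes "\<And>a. a \<in> A \<Longrightarrow> regular d (\<phi> a)" shows "regular d (\<lambda>v. \<Prod>a\<in>A. \<phi> a v)"
  using assms by (induction A rule: infinite_finite_induct) (simp_all add: regular_const regular_mult)

section \<open>Generic points of the image of the moment map\<close>

definition moment_vector :: "nat \<Rightarrow> 'a::field params \<Rightarrow> nat \<Rightarrow> 'a" where
  "moment_vector d x i = (if i \<le> d then moment x i else 0)"

lemma moment_map_moment_vector: "moment_map d x = proj_class (moment_vector d x)"
  by (simp add: moment_map_def moment_vector_def[abs_def])

lemma moment_0 [simp]: "moment x 0 = 1"
  by (cases x) simp

lemma moment_vector_0 [simp]: "moment_vector d x 0 = 1"
  by (simp add: moment_vector_def)

lemma moment_map_eq_iff:
  "moment_map d x = moment_map d y \<longleftrightarrow> (\<forall>i\<le>d. moment x i = moment y i)"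
proof
  assume eq: "moment_map d x = moment_map d y"
  have "moment_vector d x \<in> moment_map d x"
    unfolding moment_map_moment_vector proj_class_def by (auto intro: exI[of _ 1])
  then obtain c where c: "moment_vector d x = (\<lambda>i. c * moment_vector d y i)"
    unfolding eq by (auto simp: moment_map_moment_vector proj_class_def)
  from fun_cong[OF c, of 0] have "c = 1"
    by simp
  with c show "\<forall>i\<le>d. moment x i = moment y i"
    by (metis moment_vector_def mult_1)
next
  assume "\<forall>i\<le>d. moment x i = moment y i"
  then have "moment_vector d x = moment_vector d y"
    by (auto simp: moment_vector_def)
  then show "moment_map d x = moment_map d y"
    by (simp add: moment_map_moment_vector)
qed

text \<open>
  Density is checked on lines in the parameter space: along a line every form in the moments
  restricts to a univariate polynomial, so two nonzero restrictions have a nonzero product.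
\<close>

definition param_line :: "'a::field params \<Rightarrow> 'a params \<Rightarrow> 'a \<Rightarrow> 'a params" where
  "param_line x y t = (case (x, y) of ((a, b, A, B, l), (a', b', A', B', l')) \<Rightarrow>
     (a + t * (a' - a), b + t * (b' - b), A + t * (A' - A), B + t * (B' - B), l + t * (l' - l)))"

lemma param_line_0: "param_line x y 0 = x" and param_line_1: "param_line x y 1 = y"
  by (auto simp: param_line_def split: prod.splits)

definition polynomial_fun :: "('a::field \<Rightarrow> 'a) \<Rightarrow> bool" where
  "polynomial_fun f \<longleftrightarrow> (\<exists>P. f = poly P)"

lemma polynomial_fun_const: "polynomial_fun (\<lambda>t. c)"
  unfolding polynomial_fun_def by (intro exI[of _ "[:c:]"]) auto

lemma polynomial_fun_id: "polynomial_fun (\<lambda>t. t)"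
  unfolding polynomial_fun_def by (intro exI[of _ "[:0, 1:]"]) auto

lemma polynomial_fun_add:
  "polynomial_fun f \<Longrightarrow> polynomial_fun g \<Longrightarrow> polynomial_fun (\<lambda>t. f t + g t)"
  unfolding polynomial_fun_def by (auto simp flip: poly_add)

lemma polynomial_fun_diff:
  "polynomial_fun f \<Longrightarrow> polynomial_fun g \<Longrightarrow> polynomial_fun (\<lambda>t. f t - g t)"
  unfolding polynomial_fun_def by (auto simp flip: poly_diff)

lemma polynomial_fun_mult:
  "polynomial_fun f \<Longrightarrow> polynomial_fun g \<Longrightarrow> polynomial_fun (\<lambda>t. f t * g t)"
  unfolding polynomial_fun_def by (auto simp flip: poly_mult)

lemma polynomial_fun_power: "polynomial_fun f \<Longrightarrow> polynomial_fun (\<lambda>t. f t ^ k)"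
  unfolding polynomial_fun_def by (auto simp flip: poly_power)

lemma polynomial_fun_sum:
  "(\<And>a. a \<in> A \<Longrightarrow> polynomial_fun (f a)) \<Longrightarrow> polynomial_fun (\<lambda>t. \<Sum>a\<in>A. f a t)"
  by (induction A rule: infinite_finite_induct)
    (simp_all add: polynomial_fun_const polynomial_fun_add)

lemma polynomial_fun_prod:
  "(\<And>a. a \<in> A \<Longrightarrow> polynomial_fun (f a)) \<Longrightarrow> polynomial_fun (\<lambda>t. \<Prod>a\<in>A. f a t)"
  by (induction A rule: infinite_finite_induct)
    (simp_all add: polynomial_fun_const polynomial_fun_mult)

lemmas polynomial_fun_intros = polynomial_fun_const polynomial_fun_id polynomial_fun_add
  polynomial_fun_diff polynomial_fun_mult polynomial_fun_power polynomial_fun_sum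
  polynomial_fun_prod

lemma polynomial_fun_moment_line: "polynomial_fun (\<lambda>t. moment (param_line x y t) i)"
  by (cases x; cases y; cases "i = 0") (simp_all add: param_line_def polynomial_fun_intros)

lemma polynomial_fun_form_line:
  "polynomial_fun (\<lambda>t. poly_eval F (\<lambda>i. c * moment_vector d (param_line x y t) i))"
proof -
  have "polynomial_fun (\<lambda>t. moment_vector d (param_line x y t) i)" for i
    by (cases "i \<le> d")
      (simp_all add: moment_vector_def polynomial_fun_moment_line polynomial_fun_const)
  then show ?thesis
    unfolding poly_eval_def by (intro polynomial_fun_intros)
qed

text \<open>
  A form that is nonzero at one image point has a dense nonvanishing locus. To see that a form \<open>G\<close>
  vanishing on this locus also vanishes at the image of \<open>x\<close>, join \<open>x\<close> to the witness by a line. On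
  the line the product of the two forms is a polynomial that vanishes everywhere, the first factor
  is not the zero polynomial, hence the second is.
\<close>

lemma generically_on_range_moment_map:
  fixes P :: "'a::field_char_0 proj_point \<Rightarrow> bool"
  assumes reg: "regular d \<phi>"
    and witness: "\<phi> (moment_vector d x0) \<noteq> 0"
    and P: "\<And>x. \<phi> (moment_vector d x) \<noteq> 0 \<Longrightarrow> P (moment_map d x)"
  shows "generically_on d (range (moment_map d)) P"
proof -
  obtain F n where F: "form_of_degree d n F"
    and ev: "\<And>v. v 0 = 1 \<Longrightarrow> poly_eval F v = \<phi> v"
    using reg unfolding regular_def homogeneous_form_iff by metis
  define Z where "Z = {p \<in> proj_space d. \<forall>G\<in>{F}. \<forall>v\<in>p. poly_eval G v = 0}"
  have closed: "zariski_closed d Z"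
    unfolding zariski_closed_def Z_def
    by (rule exI[of _ "{F}"]) (use F in \<open>auto simp: homogeneous_form_iff\<close>)
  have Z_iff: "moment_map d x \<in> Z \<longleftrightarrow> poly_eval F (moment_vector d x) = 0" for x
  proof
    assume "moment_map d x \<in> Z"
    moreover have "moment_vector d x \<in> moment_map d x"
      unfolding moment_map_moment_vector proj_class_def by (auto intro: exI[of _ 1])
    ultimately show "poly_eval F (moment_vector d x) = 0"
      by (simp add: Z_def)
  next
    assume "poly_eval F (moment_vector d x) = 0"
    then show "moment_map d x \<in> Z"
      using moment_map_in_proj_space[of d x]
      by (auto simp: Z_def moment_map_moment_vector proj_class_def form_eval_scale[OF F])
  qed
  have dense: "range (moment_map d) \<subseteq> zariski_closure d (range (moment_map d) - Z)" (is "?A \<subseteq> _")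
    unfolding zariski_closure_def
  proof (intro subsetI InterI, elim CollectE conjE rangeE)
    fix p and x :: "'a params" and Z'
    assume p: "p = moment_map d x" and "zariski_closed d Z'"
      and sub: "?A - Z \<subseteq> Z'"
    then obtain S where Z': "Z' = {p \<in> proj_space d. \<forall>G\<in>S. \<forall>v\<in>p. poly_eval G v = 0}"
      unfolding zariski_closed_def by blast
    have "poly_eval G (\<lambda>i. c * moment_vector d x i) = 0" if "G \<in> S" "c \<noteq> 0" for G c
    proof -
      obtain A where A: "poly A t = poly_eval F (moment_vector d (param_line x0 x t))" for t
        using polynomial_fun_form_line[of F 1 d x0 x] unfolding polynomial_fun_def
        by (metis (no_types, lifting) ext mult_1)
      obtain B where B: "poly B t = poly_eval G (\<lambda>i. c * moment_vector d (param_line x0 x t) i)" for t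
        using polynomial_fun_form_line[of G c d x0 x] unfolding polynomial_fun_def by metis
      have "poly (A * B) t = 0" for t
      proof (cases "poly A t = 0")
        case False
        then have "moment_map d (param_line x0 x t) \<in> Z'"
          using sub by (auto simp: A Z_iff)
        then show ?thesis
          using that by (auto simp: Z' moment_map_moment_vector proj_class_def B)
      qed simp
      then have "A * B = 0"
        using poly_all_0_iff_0 by blast
      moreover have "poly A 0 \<noteq> 0"
        using witness by (simp add: A param_line_0 ev)
      ultimately have "B = 0"
        by auto
      then show ?thesis
        using B[of 1] by (simp add: param_line_1)
    qed
    then show "p \<in> Z'"
      unfolding p Z' using moment_map_in_proj_space[of d x]
      by (auto simp: moment_map_moment_vector proj_class_def)
  qed
  have "P p" if "p \<in> range (moment_map d) - Z" for p
    using that P by (auto simp: Z_iff ev)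
  then show ?thesis
    unfolding generically_on_def using closed dense by blast
qed

section \<open>Common roots of two polynomials\<close>

text \<open>
  The Sylvester matrix is taken with formal degrees \<open>m\<close> and \<open>n\<close>, so that its size and hence
  the shape of its determinant stay the same when the coefficients of the polynomials vary.
\<close>

definition sylvester_row :: "nat \<Rightarrow> 'a::field poly \<Rightarrow> 'a poly \<Rightarrow> nat \<Rightarrow> 'a poly" where
  "sylvester_row n p q i = (if i < n then monom 1 i * p else monom 1 (i - n) * q)"

definition sylvester_det :: "nat \<Rightarrow> nat \<Rightarrow> 'a::field poly \<Rightarrow> 'a poly \<Rightarrow> 'a" where
  "sylvester_det m n p q = det (mat (m + n) (m + n) (\<lambda>(i, j). coeff (sylvester_row n p q i) j))"

text \<open>
  The powers of a common root form a vector in the kernel.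
\<close>

lemma sylvester_det_eq_0:
  assumes "poly p e = 0" "poly q e = 0"
    and "Polynomial.degree p \<le> m" "Polynomial.degree q \<le> n" "m + n > 0"
  shows "sylvester_det m n p q = 0"
proof -
  let ?S = "mat (m + n) (m + n) (\<lambda>(i, j). coeff (sylvester_row n p q i) j)"
  let ?v = "vec (m + n) (\<lambda>j. e ^ j)"
  have "(\<Sum>j<m + n. coeff (sylvester_row n p q i) j * e ^ j) = 0" if "i < m + n" for i
  proof -
    have "Polynomial.degree (sylvester_row n p q i) < m + n"
    proof (cases "i < n")
      case True
      have "Polynomial.degree (monom 1 i * p) \<le> i + Polynomial.degree p"
        by (rule order_trans[OF degree_mult_le]) (simp add: degree_monom_eq)
      with True assms show ?thesis
        by (simp add: sylvester_row_def)
    next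
      case False
      have "Polynomial.degree (monom 1 (i - n) * q) \<le> i - n + Polynomial.degree q"
        by (rule order_trans[OF degree_mult_le]) (simp add: degree_monom_eq)
      with False that assms show ?thesis
        by (simp add: sylvester_row_def)
    qed
    then have "(\<Sum>j<m + n. coeff (sylvester_row n p q i) j * e ^ j) = poly (sylvester_row n p q i) e"
      unfolding poly_altdef
      by (intro sum.mono_neutral_right) (auto simp: coeff_eq_0)
    also have "\<dots> = 0"
      using assms by (simp add: sylvester_row_def)
    finally show ?thesis .
  qed
  then have "?S *\<^sub>v ?v = 0\<^sub>v (m + n)"
    by (intro eq_vecI) (simp_all add: scalar_prod_def atLeast0LessThan)
  moreover have "?v \<noteq> 0\<^sub>v (m + n)"
  proof
    assume "?v = 0\<^sub>v (m + n)"
    then have "?v $ 0 = 0\<^sub>v (m + n) $ 0"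
      by simp
    with assms(5) show False
      by simp
  qed
  ultimately show ?thesis
    unfolding sylvester_det_def
    by (subst det_0_iff_vec_prod_zero_field[of _ "m + n"]) (auto intro!: exI[of _ ?v])
qed

text \<open>
  A vector in the kernel of the transpose is a relation \<open>U p + V q = 0\<close> with \<open>V\<close> of degree less
  than \<open>m\<close>. At the \<open>m\<close> roots of \<open>p\<close> the polynomial \<open>V\<close> must vanish, so it is zero.
\<close>

lemma sylvester_det_neq_0:
  assumes "p \<noteq> 0" and R: "card R = m" "\<And>e. e \<in> R \<Longrightarrow> poly p e = 0" "\<And>e. e \<in> R \<Longrightarrow> poly q e \<noteq> 0"
    and deg: "Polynomial.degree p \<le> m" "Polynomial.degree q \<le> n"
  shows "sylvester_det m n p q \<noteq> 0"
proof
  let ?S = "mat (m + n) (m + n) (\<lambda>(i, j). coeff (sylvester_row n p q i) j)"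
  assume "sylvester_det m n p q = 0"
  then have "det (transpose_mat ?S) = 0"
    by (subst det_transpose[of _ "m + n"]) (simp_all add: sylvester_det_def)
  then obtain w where w: "w \<in> carrier_vec (m + n)" "w \<noteq> 0\<^sub>v (m + n)"
    and Sw: "transpose_mat ?S *\<^sub>v w = 0\<^sub>v (m + n)"
    using det_0_iff_vec_prod_zero_field[of "transpose_mat ?S" "m + n"] by auto
  define U where "U = (\<Sum>i<n. monom (w $ i) i)"
  define V where "V = (\<Sum>i<m. monom (w $ (n + i)) i)"
  have coeff_U: "coeff U i = w $ i" if "i < n" for i
    using that by (simp add: U_def coeff_sum)
  have coeff_V: "coeff V i = w $ (n + i)" if "i < m" for i
    using that by (simp add: V_def coeff_sum)
  have "U * p + V * q = (\<Sum>i<m + n. Polynomial.smult (w $ i) (sylvester_row n p q i))"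
  proof -
    have "(\<Sum>i<m + n. Polynomial.smult (w $ i) (sylvester_row n p q i))
        = (\<Sum>i<n. Polynomial.smult (w $ i) (monom 1 i * p)) + (\<Sum>i<m. Polynomial.smult (w $ (n + i)) (monom 1 i * q))"
    proof -
      have "(\<Sum>i<m + n. Polynomial.smult (w $ i) (sylvester_row n p q i))
          = (\<Sum>i<n. Polynomial.smult (w $ i) (sylvester_row n p q i))
            + (\<Sum>i=n..<n + m. Polynomial.smult (w $ i) (sylvester_row n p q i))"
        by (subst add.commute[of m], simp only: lessThan_atLeast0, rule sum.atLeastLessThan_concat[symmetric]) auto
      also have "(\<Sum>i=n..<n + m. Polynomial.smult (w $ i) (sylvester_row n p q i))
          = (\<Sum>i<m. Polynomial.smult (w $ (n + i)) (sylvester_row n p q (n + i)))"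
        using sum.shift_bounds_nat_ivl[of "\<lambda>i. Polynomial.smult (w $ i) (sylvester_row n p q i)" 0 n m]
        by (simp add: lessThan_atLeast0 add.commute)
      finally show ?thesis
        by (simp add: sylvester_row_def)
    qed
    then show ?thesis
      by (simp add: U_def V_def sum_distrib_right smult_monom flip: mult_smult_left)
  qed
  also have "\<dots> = 0"
  proof (rule poly_eqI)
    fix j
    show "coeff (\<Sum>i<m + n. Polynomial.smult (w $ i) (sylvester_row n p q i)) j = coeff 0 j"
    proof (cases "j < m + n")
      case True
      have "(transpose_mat ?S *\<^sub>v w) $ j = 0"
        using True by (simp add: Sw)
      then show ?thesis
        using True w(1)
        by (simp add: scalar_prod_def coeff_sum atLeast0LessThan mult.commute)
    next
      case False
      have "coeff (sylvester_row n p q i) j = 0" if "i < m + n" for i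
        using that False deg by (auto simp: sylvester_row_def coeff_monom_mult intro!: coeff_eq_0)
      then show ?thesis
        by (simp add: coeff_sum)
    qed
  qed
  finally have UV: "U * p + V * q = 0" .
  have "V = 0"
  proof (rule ccontr)
    assume "V \<noteq> 0"
    have "poly V e = 0" if "e \<in> R" for e
    proof -
      have "poly (U * p + V * q) e = 0"
        by (simp only: UV poly_0)
      with R that show ?thesis
        by simp
    qed
    then have "card R \<le> card {e. poly V e = 0}"
      using poly_roots_finite[OF \<open>V \<noteq> 0\<close>] by (intro card_mono) auto
    also have "\<dots> \<le> Polynomial.degree V"
      using card_poly_roots_bound[OF \<open>V \<noteq> 0\<close>] by simp
    finally have "m \<le> Polynomial.degree V"
      using R(1) by simp
    moreover have "coeff V i = 0" if "i \<ge> m" for i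
      using that by (simp add: V_def coeff_sum)
    ultimately show False
      using \<open>V \<noteq> 0\<close> leading_coeff_0_iff by metis
  qed
  with UV \<open>p \<noteq> 0\<close> have "U = 0"
    by simp
  have "w = 0\<^sub>v (m + n)"
  proof (rule eq_vecI)
    fix i assume "i < dim_vec (0\<^sub>v (m + n) :: 'a vec)"
    then show "w $ i = 0\<^sub>v (m + n) $ i"
      using coeff_U[of i] coeff_V[of "i - n"] by (cases "i < n") (simp_all add: \<open>U = 0\<close> \<open>V = 0\<close>)
  qed (use w(1) in simp)
  with w(2) show False ..
qed

lemma card_roots_eq_degree:
  fixes p :: "'a::{alg_closed_field, field_char_0} poly"
  assumes simple: "\<And>e. poly p e = 0 \<Longrightarrow> poly (pderiv p) e \<noteq> 0" and "p \<noteq> 0"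
  shows "card {e. poly p e = 0} = Polynomial.degree p"
proof -
  obtain M where M: "size M = Polynomial.degree p"
    "p = Polynomial.smult (lead_coeff p) (\<Prod>x\<in>#M. [:- x, 1:])"
    using alg_closed_imp_factorization[OF \<open>p \<noteq> 0\<close>] by blast
  have prod_nz: "(\<Prod>x\<in>#K. [:- x, 1:]) \<noteq> 0" for K :: "'a multiset"
    by (induction K) (simp_all del: mult_pCons_left)
  have "proots p = proots (\<Prod>x\<in>#M. [:- x, 1:])"
    by (subst M(2)) (use \<open>p \<noteq> 0\<close> in simp)
  also have "\<dots> = M"
  proof (induction M)
    case (add x K)
    have "proots ([:- x, 1:] * (\<Prod>x\<in>#K. [:- x, 1:])) = proots [:- x, 1:] + proots (\<Prod>x\<in>#K. [:- x, 1:])"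
      by (rule proots_mult[OF _ prod_nz]) simp
    with add show ?case
      by (simp del: mult_pCons_left)
  qed simp
  finally have M_eq: "M = proots p" ..
  have "rsquarefree p"
    unfolding rsquarefree_roots using simple by blast
  then have count: "count (proots p) e = 1" if "poly p e = 0" for e
    using that \<open>p \<noteq> 0\<close> rsquarefree_root_order by simp
  have "Polynomial.degree p = (\<Sum>e\<in>{e. poly p e = 0}. count (proots p) e)"
    using M(1) \<open>p \<noteq> 0\<close> by (simp add: M_eq size_multiset_overloaded_eq)
  also have "\<dots> = (\<Sum>e\<in>{e. poly p e = 0}. 1)"
    by (intro sum.cong refl) (use count in simp)
  finally show ?thesis
    by simp
qed

text \<open>
  A polynomial whose coefficients are regular functions of the moments, with a degree bound that
  holds uniformly; the bound fixes the size of the Sylvester matrix.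
\<close>

definition regular_poly :: "nat \<Rightarrow> nat \<Rightarrow> ((nat \<Rightarrow> 'a::field) \<Rightarrow> 'a poly) \<Rightarrow> bool" where
  "regular_poly d n f \<longleftrightarrow>
     (\<forall>v. Polynomial.degree (f v) \<le> n) \<and> (\<forall>k. regular d (\<lambda>v. coeff (f v) k))"

lemma regular_poly_mono: "regular_poly d m f \<Longrightarrow> m \<le> n \<Longrightarrow> regular_poly d n f"
  by (auto simp: regular_poly_def intro: order_trans)

lemma regular_poly_0: "regular_poly d n (\<lambda>v. 0)"
  by (simp add: regular_poly_def regular_const)

lemma regular_poly_pCons:
  assumes "regular d \<phi>" "regular_poly d n f"
  shows "regular_poly d (Suc n) (\<lambda>v. pCons (\<phi> v) (f v))"
proof -
  have "regular d (\<lambda>v. coeff (pCons (\<phi> v) (f v)) k)" for k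
    using assms by (cases k) (simp_all add: regular_poly_def)
  then show ?thesis
    using assms by (auto simp: regular_poly_def intro: order_trans[OF degree_pCons_le])
qed

lemma regular_poly_const: "regular d \<phi> \<Longrightarrow> regular_poly d 0 (\<lambda>v. [:\<phi> v:])"
proof -
  assume "regular d \<phi>"
  then have "regular d (\<lambda>v. coeff [:\<phi> v:] k)" for k
    by (cases k) (simp_all add: regular_const)
  then show ?thesis
    by (simp add: regular_poly_def)
qed

lemma regular_poly_mult:
  assumes "regular_poly d m f" "regular_poly d n g"
  shows "regular_poly d (m + n) (\<lambda>v. f v * g v)"
  using assms unfolding regular_poly_def
  by (auto simp: coeff_mult intro!: regular_sum regular_mult
      order_trans[OF degree_mult_le] add_mono)

lemma regular_poly_add:
  assumes "regular_poly d m f" "regular_poly d n g"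
  shows "regular_poly d (max m n) (\<lambda>v. f v + g v)"
  using assms unfolding regular_poly_def
  by (auto intro!: regular_add order_trans[OF degree_add_le_max] max.mono)

lemma regular_poly_uminus: "regular_poly d n f \<Longrightarrow> regular_poly d n (\<lambda>v. - f v)"
  by (simp add: regular_poly_def regular_uminus)

lemma regular_poly_diff:
  assumes "regular_poly d m f" "regular_poly d n g"
  shows "regular_poly d (max m n) (\<lambda>v. f v - g v)"
  using regular_poly_add[OF assms(1) regular_poly_uminus[OF assms(2)]] by simp

lemma regular_poly_smult: "regular_poly d n f \<Longrightarrow> regular_poly d n (\<lambda>v. Polynomial.smult c (f v))"
  by (auto simp: regular_poly_def intro!: regular_intros intro: order_trans[OF degree_smult_le])

lemma regular_poly_power: "regular_poly d n f \<Longrightarrow> regular_poly d (n * k) (\<lambda>v. f v ^ k)"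
proof (induction k)
  case 0
  then show ?case
    using regular_poly_const[OF regular_const, of d 1] by (simp add: one_pCons)
next
  case (Suc k)
  then show ?case
    using regular_poly_mult[of d n f "n * k"] by simp
qed

lemma regular_poly_pderiv:
  fixes f :: "(nat \<Rightarrow> 'a::field_char_0) \<Rightarrow> 'a poly"
  assumes "regular_poly d n f"
  shows "regular_poly d (n - 1) (\<lambda>v. pderiv (f v))"
  using assms unfolding regular_poly_def coeff_pderiv degree_pderiv
  by (auto intro!: regular_intros diff_le_mono)

lemmas regular_poly_intros = regular_poly_0 regular_poly_const regular_poly_pCons
  regular_poly_mult regular_poly_add regular_poly_uminus regular_poly_diff regular_poly_smult
  regular_poly_power regular_poly_pderiv

lemma regular_sylvester_det:
  assumes "regular_poly d k f" "regular_poly d l g"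
  shows "regular d (\<lambda>v. sylvester_det m n (f v) (g v))"
proof -
  have shift: "regular d (\<lambda>v. coeff (monom 1 i * h v) j)" if "regular_poly d r h" for h i j r
    using that by (cases "j < i") (simp_all add: coeff_monom_mult regular_poly_def regular_const)
  have row: "regular d (\<lambda>v. coeff (sylvester_row n (f v) (g v) i) j)" for i j
    by (cases "i < n") (simp_all add: sylvester_row_def shift[OF assms(1)] shift[OF assms(2)])
  have "sylvester_det m n (f v) (g v) = (\<Sum>p\<in>{p. p permutes {0..<m + n}}.
      signof p * (\<Prod>i\<in>{0..<m + n}. coeff (sylvester_row n (f v) (g v) i) (p i)))" for v
  proof -
    have "p i < m + n" if "p permutes {0..<m + n}" "i < m + n" for p i
      using permutes_in_image[OF that(1), of i] that(2) by simp
    then show ?thesis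
      unfolding sylvester_det_def
      by (subst det_def'[of _ "m + n"]) (auto intro!: sum.cong prod.cong)
  qed
  then show ?thesis
    by (simp only:) (intro regular_sum regular_mult regular_prod regular_const row)
qed

section \<open>The recurrence satisfied by the moments\<close>

text \<open>
  A component with node \<open>a\<close> contributes to the moments the functional
  \<open>p \<mapsto> p(a) + A p'(a)\<close>, which kills every multiple of \<open>(x - a)\<^sup>2\<close>. Hence the moments of a mixture with
  nodes \<open>a, b\<close> kill \<open>x\<^sup>k (x\<^sup>2 - e x + f)\<^sup>2\<close> for \<open>e = a + b\<close> and \<open>f = a b\<close>. For given moments this
  is a conic in the unknowns \<open>(e, f)\<close>.
\<close>

definition conic :: "nat \<Rightarrow> (nat \<Rightarrow> 'a::field) \<Rightarrow> 'a \<Rightarrow> 'a \<Rightarrow> 'a" where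
  "conic k v e f = v (k + 4) - 2 * e * v (k + 3) + (e\<^sup>2 + 2 * f) * v (k + 2)
     - 2 * e * f * v (k + 1) + f\<^sup>2 * v k"

lemma moment_components:
  "moment (a, b, A, B, l) i = l * (a ^ i + of_nat i * A * a ^ (i - 1))
     + (1 - l) * (b ^ i + of_nat i * B * b ^ (i - 1))"
  by simp

lemma conic_node:
  fixes a :: "'a::field"
  assumes "a\<^sup>2 - e * a + f = 0"
  shows "conic k (\<lambda>i. a ^ i + of_nat i * A * a ^ (i - 1)) e f = 0"
proof -
  have f: "f = e * a - a\<^sup>2"
    using assms by (simp add: add_eq_0_iff)
  show ?thesis
  proof (cases k)
    case 0
    then show ?thesis
      unfolding conic_def f by (simp add: eval_nat_numeral algebra_simps)
  next
    case (Suc j)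
    then show ?thesis
      unfolding conic_def f by (simp add: eval_nat_numeral algebra_simps)
  qed
qed

lemma conic_combination:
  "conic k (\<lambda>i. c * u i + c' * w i) e f = c * conic k u e f + c' * conic k w e f"
  by (simp add: conic_def algebra_simps)

lemma conic_moment: "conic k (moment (a, b, A, B, l)) (a + b) (a * b) = 0"
proof -
  have "conic k (moment (a, b, A, B, l)) (a + b) (a * b)
      = conic k (\<lambda>i. l * (a ^ i + of_nat i * A * a ^ (i - 1))
          + (1 - l) * (b ^ i + of_nat i * B * b ^ (i - 1))) (a + b) (a * b)"
    unfolding moment_components[abs_def] ..
  also have "\<dots> = 0"
    unfolding conic_combination
    by (subst (1 2) conic_node) (simp_all add: power2_eq_square algebra_simps)
  finally show ?thesis .
qed

lemma conic_cong: "(\<And>i. i \<le> k + 4 \<Longrightarrow> u i = w i) \<Longrightarrow> conic k u e f = conic k w e f"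
  by (simp add: conic_def)

text \<open>
  The recurrence passes agreement of two sequences on to the next term.
\<close>

lemma conic_determines:
  "conic k u e f = conic k w e f \<Longrightarrow> (\<And>i. i < k + 4 \<Longrightarrow> u i = w i) \<Longrightarrow> u (k + 4) = w (k + 4)"
  by (simp add: conic_def)

section \<open>Elimination\<close>

text \<open>
  Let \<open>v\<^sub>0 = 1\<close>. The term \<open>f\<^sup>2\<close> cancels in the second conic minus \<open>v\<^sub>1\<close> times the first,
  and what remains is linear in \<open>f\<close>: it says \<open>lin_den(e) f = lin_num(e)\<close>. Substitution into the first
  conic and clearing of denominators gives the quartic \<open>eliminant\<close> in \<open>e\<close>.
\<close>

definition lin_den :: "(nat \<Rightarrow> 'a::field) \<Rightarrow> 'a poly" where
  "lin_den v = [:2 * (v 3 - v 1 * v 2), - 2 * (v 2 - (v 1)\<^sup>2):]"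

definition lin_num :: "(nat \<Rightarrow> 'a::field) \<Rightarrow> 'a poly" where
  "lin_num v = [:- (v 5 - v 1 * v 4), 2 * (v 4 - v 1 * v 3), - (v 3 - v 1 * v 2):]"

definition eliminant :: "(nat \<Rightarrow> 'a::field) \<Rightarrow> 'a poly" where
  "eliminant v = lin_den v ^ 2 * [:v 4, - 2 * v 3, v 2:]
     + lin_num v * lin_den v * [:2 * v 2, - 2 * v 1:] + lin_num v ^ 2"

text \<open>
  At a root \<open>e\<close> of the eliminant, with \<open>f = lin_num(e) / lin_den(e)\<close>, these two are
  \<open>lin_den(e)\<close> times the discriminant \<open>\<delta>\<^sup>2 = e\<^sup>2 - 4 f\<close> of the nodes and \<open>lin_den(e)\<close> times
  \<open>half_weight\<close> (see below), which is \<open>\<delta>\<^sup>3 (\<lambda> - 1/2)\<close>.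
\<close>

definition discriminant_num :: "(nat \<Rightarrow> 'a::field) \<Rightarrow> 'a poly" where
  "discriminant_num v = [:0, 0, 1:] * lin_den v - Polynomial.smult 4 (lin_num v)"

definition weight_num :: "(nat \<Rightarrow> 'a::field) \<Rightarrow> 'a poly" where
  "weight_num v = lin_den v * [:- 2 * v 3, 3 * v 2, - (3 / 2) * v 1, 1 / 4:]
     + discriminant_num v * [:3 / 2 * v 1, - 3 / 4:]"

text \<open>
  The last factor is \<open>lin_den(e)\<^sup>3 (\<delta>\<^sup>6 - 4 half_weight\<^sup>2) = 4 lin_den(e)\<^sup>3 \<delta>\<^sup>6 \<lambda> (1 - \<lambda>)\<close> at a
  root \<open>e\<close> of the eliminant. So this polynomial is nonzero at \<open>e\<close> exactly when \<open>e\<close> is a simple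
  root, \<open>f\<close> is determined by \<open>e\<close>, the two nodes differ and both weights are nonzero.
\<close>

definition degeneracy :: "(nat \<Rightarrow> 'a::field) \<Rightarrow> 'a poly" where
  "degeneracy v = pderiv (eliminant v) * lin_den v * discriminant_num v
     * (discriminant_num v ^ 3 - Polynomial.smult 4 (weight_num v ^ 2 * lin_den v))"

lemma lin_den_conics:
  fixes v :: "nat \<Rightarrow> 'a::field"
  assumes "v 0 = 1"
  shows "poly (lin_den v) e * f - poly (lin_num v) e = conic 1 v e f - v 1 * conic 0 v e f"
  using assms
  by (simp add: conic_def lin_den_def lin_num_def numeral_eq_Suc power2_eq_square algebra_simps)

lemma eliminant_conic:
  fixes v :: "nat \<Rightarrow> 'a::field"
  assumes "v 0 = 1" "poly (lin_den v) e * f = poly (lin_num v) e"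
  shows "poly (eliminant v) e = (poly (lin_den v) e)\<^sup>2 * conic 0 v e f"
  unfolding eliminant_def using assms
  by (simp add: conic_def numeral_eq_Suc power2_eq_square algebra_simps flip: assms(2))

lemma regular_poly_lin_den: "5 \<le> d \<Longrightarrow> regular_poly d 1 lin_den"
  unfolding lin_den_def[abs_def]
  by (rule regular_poly_mono, (rule regular_poly_intros regular_intros | simp)+)

lemma regular_poly_lin_num: "5 \<le> d \<Longrightarrow> regular_poly d 2 lin_num"
  unfolding lin_num_def[abs_def]
  by (rule regular_poly_mono, (rule regular_poly_intros regular_intros | simp)+)

lemma regular_poly_eliminant: "5 \<le> d \<Longrightarrow> regular_poly d 4 eliminant"
  unfolding eliminant_def[abs_def]
  by (rule regular_poly_mono,
      (rule regular_poly_lin_den regular_poly_lin_num regular_poly_intros regular_intros | simp)+)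

lemma degree_eliminant:
  fixes v :: "nat \<Rightarrow> 'a::field"
  shows "Polynomial.degree (eliminant v) \<le> 4"
proof -
  have "regular_poly 5 4 (eliminant :: (nat \<Rightarrow> 'a) \<Rightarrow> 'a poly)"
    by (rule regular_poly_eliminant) simp
  then show ?thesis
    by (simp add: regular_poly_def)
qed

text \<open>
  The value of the moment functional at the cubic \<open>3/2 \<delta>\<^sup>2 y - 2 y\<^sup>3\<close>, where \<open>y = x - e/2\<close> is
  centred between the nodes. This cubic has critical points at the nodes, with values
  \<open>\<delta>\<^sup>3/2\<close> and \<open>- \<delta>\<^sup>3/2\<close>, so it sees the weights but not the slopes.
\<close>

definition half_weight :: "(nat \<Rightarrow> 'a::field) \<Rightarrow> 'a \<Rightarrow> 'a \<Rightarrow> 'a" where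
  "half_weight v e f = - 2 * v 3 + 3 * e * v 2 - 3 / 2 * e\<^sup>2 * v 1 + e ^ 3 / 4
     + 3 / 2 * (e\<^sup>2 - 4 * f) * (v 1 - e / 2)"

lemma discriminant_num_eq:
  assumes "poly (lin_den v) e * f = poly (lin_num v) e"
  shows "poly (discriminant_num v) e = poly (lin_den v) e * (e\<^sup>2 - 4 * f)"
  by (simp add: discriminant_num_def power2_eq_square algebra_simps flip: assms)

lemma weight_num_eq:
  fixes v :: "nat \<Rightarrow> 'a::field_char_0"
  assumes "poly (lin_den v) e * f = poly (lin_num v) e"
  shows "poly (weight_num v) e = poly (lin_den v) e * half_weight v e f"
  unfolding weight_num_def half_weight_def
  by (simp add: discriminant_num_eq[OF assms] power2_eq_square power3_eq_cube field_simps)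

lemma half_weight_moment:
  fixes a :: "'a::field_char_0"
  shows "2 * half_weight (moment (a, b, A, B, l)) (a + b) (a * b) = (a - b) ^ 3 * (2 * l - 1)"
  unfolding half_weight_def moment_components by (simp add: eval_nat_numeral field_simps)

text \<open>
  The left-hand side is the moment functional at \<open>(x - a) (x - b)\<^sup>2\<close>, the Hermite basis
  polynomial dual, up to the factor \<open>(a - b)\<^sup>2\<close>, to the derivative at \<open>a\<close>.
\<close>

lemma first_slope_moment:
  fixes a b A B l :: "'a::field_char_0"
  defines "m \<equiv> moment (a, b, A, B, l)"
  shows "m 3 - (a + 2 * b) * m 2 + (b\<^sup>2 + 2 * a * b) * m 1 - a * b\<^sup>2 = (a - b)\<^sup>2 * (l * A)"
  unfolding m_def moment_components by (simp add: eval_nat_numeral field_simps)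

lemma second_slope_moment:
  fixes a b A B l :: "'a::field_char_0"
  defines "m \<equiv> moment (a, b, A, B, l)"
  shows "m 3 - (b + 2 * a) * m 2 + (a\<^sup>2 + 2 * a * b) * m 1 - a\<^sup>2 * b = (a - b)\<^sup>2 * ((1 - l) * B)"
  unfolding m_def moment_components by (simp add: eval_nat_numeral field_simps)

lemma moments_determine_components:
  fixes a :: "'a::field_char_0"
  assumes "a \<noteq> b" "l \<noteq> 0" "l \<noteq> 1"
    and eq: "\<And>i. i \<le> 3 \<Longrightarrow> moment (a, b, A, B, l) i = moment (a, b, A', B', l') i"
  shows "(A, B, l) = (A', B', l')"
proof -
  have ne: "a - b \<noteq> 0"
    using assms by simp
  have e: "moment (a, b, A, B, l) 1 = moment (a, b, A', B', l') 1"
    "moment (a, b, A, B, l) 2 = moment (a, b, A', B', l') 2"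
    "moment (a, b, A, B, l) 3 = moment (a, b, A', B', l') 3"
    by (rule eq, simp)+
  have "half_weight (moment (a, b, A, B, l)) (a + b) (a * b)
      = half_weight (moment (a, b, A', B', l')) (a + b) (a * b)"
    unfolding half_weight_def by (simp only: e)
  then have l: "l' = l"
    using half_weight_moment[of a b A B l] half_weight_moment[of a b A' B' l'] ne
    by (metis add_diff_cancel_left' diff_add_cancel mult_cancel_left power_not_zero zero_neq_numeral)
  have "(a - b)\<^sup>2 * (l * A) = (a - b)\<^sup>2 * (l' * A')"
    unfolding first_slope_moment[of a b A B l, symmetric] first_slope_moment[of a b A' B' l', symmetric]
    by (simp only: e)
  then have A: "A = A'"
    using ne assms l by simp
  have "(a - b)\<^sup>2 * ((1 - l) * B) = (a - b)\<^sup>2 * ((1 - l') * B')"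
    unfolding second_slope_moment[of a b A B l, symmetric] second_slope_moment[of a b A' B' l', symmetric]
    by (simp only: e)
  then have "B = B'"
    using ne assms l by simp
  with l A show ?thesis
    by simp
qed

text \<open>
  Hermite interpolation at the double nodes \<open>a, b\<close> represents the functional given by
  \<open>v\<^sub>0, \<dots>, v\<^sub>3\<close> as \<open>l p(a) + P p'(a) + (1 - l) p(b) + Q p'(b)\<close>. Division by the
  weights is needed to pass from \<open>P, Q\<close> to the parameters \<open>A, B\<close>; the inequality says that both
  weights are nonzero.
\<close>

lemma components_exist:
  fixes a :: "'a::field_char_0"
  assumes v0: "v 0 = 1" and ne: "a \<noteq> b"
    and weights: "(a - b) ^ 6 \<noteq> 4 * (half_weight v (a + b) (a * b))\<^sup>2"
  shows "\<exists>A B l. \<forall>i\<le>3. moment (a, b, A, B, l) i = v i"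
proof -
  define d where "d = a - b"
  have d: "d \<noteq> 0" and a: "a = b + d"
    using ne by (simp_all add: d_def)
  define W where "W = half_weight v (a + b) (a * b)"
  define l where "l = 1 / 2 + W / d ^ 3"
  define P where "P = (v 3 - (a + 2 * b) * v 2 + (b\<^sup>2 + 2 * a * b) * v 1 - a * b\<^sup>2) / d\<^sup>2"
  define Q where "Q = (v 3 - (b + 2 * a) * v 2 + (a\<^sup>2 + 2 * a * b) * v 1 - a\<^sup>2 * b) / d\<^sup>2"
  \<comment> \<open>\<open>l\<close> solves \<open>W = d\<^sup>3 (l - 1/2)\<close>, the identity satisfied by the weight of a mixture\<close>
  have "l * (1 - l) * (4 * d ^ 6) = d ^ 6 - 4 * W\<^sup>2"
    using d by (simp add: l_def field_simps power2_eq_square eval_nat_numeral)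
  with weights have l: "l \<noteq> 0" "1 - l \<noteq> 0"
    by (auto simp: W_def d_def)
  have W: "W = - 2 * v 3 + 3 * (a + b) * v 2 - 3 / 2 * (a + b)\<^sup>2 * v 1 + (a + b) ^ 3 / 4
     + 3 / 2 * d\<^sup>2 * (v 1 - (a + b) / 2)"
    unfolding W_def half_weight_def d_def by (simp add: power2_eq_square algebra_simps)
  have "l * a + P + ((1 - l) * b + Q) = v 1"
    using d unfolding l_def W P_def Q_def a
    by (simp add: field_simps power2_eq_square eval_nat_numeral)
  moreover have "l * a\<^sup>2 + 2 * a * P + ((1 - l) * b\<^sup>2 + 2 * b * Q) = v 2"
    using d unfolding l_def W P_def Q_def a
    by (simp add: field_simps power2_eq_square eval_nat_numeral)
  moreover have "l * a ^ 3 + 3 * a\<^sup>2 * P + ((1 - l) * b ^ 3 + 3 * b\<^sup>2 * Q) = v 3"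
    using d unfolding l_def W P_def Q_def a
    by (simp add: field_simps power2_eq_square eval_nat_numeral)
  ultimately have sums: "l * a + P + ((1 - l) * b + Q) = v 1"
    "l * a\<^sup>2 + 2 * a * P + ((1 - l) * b\<^sup>2 + 2 * b * Q) = v 2"
    "l * a ^ 3 + 3 * a\<^sup>2 * P + ((1 - l) * b ^ 3 + 3 * b\<^sup>2 * Q) = v 3"
    by simp_all
  have "moment (a, b, P / l, Q / (1 - l), l) i = v i" if "i \<le> 3" for i
  proof (cases "i = 0")
    case False
    with that have i: "i = 1 \<or> i = 2 \<or> i = 3"
      by auto
    have "moment (a, b, P / l, Q / (1 - l), l) i
        = l * a ^ i + of_nat i * a ^ (i - 1) * P + ((1 - l) * b ^ i + of_nat i * b ^ (i - 1) * Q)"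
      using False l by (simp add: distrib_left mult_ac)
    with i sums show ?thesis
      by auto
  qed (simp add: v0)
  then show ?thesis
    by blast
qed

section \<open>The fibers\<close>

definition moment_fiber :: "nat \<Rightarrow> (nat \<Rightarrow> 'a::field) \<Rightarrow> 'a params set" where
  "moment_fiber d v = {x. \<forall>i\<le>d. moment x i = v i}"

text \<open>
  The root of the eliminant that a parameter vector belongs to. Being symmetric in the nodes it is
  constant on exchange orbits, and on nondegenerate fibers it separates them.
\<close>

fun node_sum :: "'a::field params \<Rightarrow> 'a" where
  "node_sum (a, b, A, B, l) = a + b"

lemma node_sum_exchange: "node_sum (exchange x) = node_sum x"
  by (cases x) (simp add: add.commute)

lemma exchange_in_moment_fiber: "x \<in> moment_fiber d v \<Longrightarrow> exchange x \<in> moment_fiber d v"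
  by (simp add: moment_fiber_def moment_exchange)

definition nondegenerate :: "(nat \<Rightarrow> 'a::field) \<Rightarrow> bool" where
  "nondegenerate v \<longleftrightarrow> v 0 = 1 \<and> coeff (eliminant v) 4 \<noteq> 0 \<and>
     (\<forall>e. poly (eliminant v) e = 0 \<longrightarrow> poly (degeneracy v) e \<noteq> 0)"

lemma fiber_conic:
  assumes "(a, b, A, B, l) \<in> moment_fiber d v" "k + 4 \<le> d"
  shows "conic k v (a + b) (a * b) = 0"
proof -
  have "conic k v (a + b) (a * b) = conic k (moment (a, b, A, B, l)) (a + b) (a * b)"
    using assms by (intro conic_cong) (simp add: moment_fiber_def)
  then show ?thesis
    by (simp only: conic_moment)
qed

lemma fiber_elimination:
  assumes v: "v 0 = 1" and x: "(a, b, A, B, l) \<in> moment_fiber 5 v"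
  shows "poly (lin_den v) (a + b) * (a * b) = poly (lin_num v) (a + b)"
    and "poly (eliminant v) (a + b) = 0"
proof -
  have c: "conic 0 v (a + b) (a * b) = 0" "conic 1 v (a + b) (a * b) = 0"
    using fiber_conic[OF x, of 0] fiber_conic[OF x, of 1] by simp_all
  show lin: "poly (lin_den v) (a + b) * (a * b) = poly (lin_num v) (a + b)"
    using lin_den_conics[of v "a + b" "a * b", OF v] c by simp
  show "poly (eliminant v) (a + b) = 0"
    using eliminant_conic[OF v lin] c by simp
qed

lemma nondegenerate_root:
  fixes v :: "nat \<Rightarrow> 'a::field_char_0"
  assumes "nondegenerate v" "poly (eliminant v) e = 0"
    and lin: "poly (lin_den v) e * f = poly (lin_num v) e"
  shows "poly (lin_den v) e \<noteq> 0" and "e\<^sup>2 - 4 * f \<noteq> 0"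
    and "(e\<^sup>2 - 4 * f) ^ 3 \<noteq> 4 * (half_weight v e f)\<^sup>2"
proof -
  have deg: "poly (degeneracy v) e \<noteq> 0"
    using assms by (simp add: nondegenerate_def)
  then show den: "poly (lin_den v) e \<noteq> 0"
    by (auto simp: degeneracy_def)
  have "poly (discriminant_num v) e \<noteq> 0"
    using deg by (auto simp: degeneracy_def)
  then show "e\<^sup>2 - 4 * f \<noteq> 0"
    by (auto simp: discriminant_num_eq[OF lin])
  have "poly (discriminant_num v) e ^ 3 - 4 * (poly (weight_num v) e ^ 2 * poly (lin_den v) e) \<noteq> 0"
    using deg by (auto simp: degeneracy_def)
  then show "(e\<^sup>2 - 4 * f) ^ 3 \<noteq> 4 * (half_weight v e f)\<^sup>2"
    unfolding discriminant_num_eq[OF lin] weight_num_eq[OF lin]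
    by (auto simp: power_mult_distrib power2_eq_square power3_eq_cube mult.assoc)
qed

lemma fiber_components_nondegenerate:
  fixes v :: "nat \<Rightarrow> 'a::field_char_0"
  assumes nd: "nondegenerate v" and x: "(a, b, A, B, l) \<in> moment_fiber 5 v"
  shows "a \<noteq> b" "l \<noteq> 0" "l \<noteq> 1"
proof -
  have v: "v 0 = 1"
    using nd by (simp add: nondegenerate_def)
  note root = nondegenerate_root[OF nd fiber_elimination(2,1)[OF v x]]
  have sq: "(a + b)\<^sup>2 - 4 * (a * b) = (a - b)\<^sup>2"
    by (simp add: power2_eq_square algebra_simps)
  show "a \<noteq> b"
    using root(2) unfolding sq by auto
  have "half_weight v (a + b) (a * b) = half_weight (moment (a, b, A, B, l)) (a + b) (a * b)"
    using x unfolding half_weight_def moment_fiber_def by (simp del: moment.simps)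
  then have "2 * half_weight v (a + b) (a * b) = (a - b) ^ 3 * (2 * l - 1)"
    by (simp only: half_weight_moment)
  moreover have "4 * (half_weight v (a + b) (a * b))\<^sup>2 = (2 * half_weight v (a + b) (a * b))\<^sup>2"
    by (simp add: power_mult_distrib)
  ultimately have "4 * (half_weight v (a + b) (a * b))\<^sup>2 = ((a - b) ^ 3 * (2 * l - 1))\<^sup>2"
    by (simp only:)
  also have "\<dots> = (a - b) ^ 6 * (2 * l - 1)\<^sup>2"
    by (simp add: power_mult_distrib flip: power_mult)
  finally have "(a - b) ^ 6 \<noteq> (a - b) ^ 6 * (2 * l - 1)\<^sup>2"
    using root(3) unfolding sq by (simp flip: power_mult)
  then show "l \<noteq> 0" "l \<noteq> 1"
    by auto
qed

text \<open>
  The node sum determines the node product, hence the nodes up to order, and for distinct nodes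
  the weights and slopes are determined by Hermite interpolation.
\<close>

lemma fiber_node_sum_inj:
  fixes v :: "nat \<Rightarrow> 'a::field_char_0"
  assumes nd: "nondegenerate v" and x: "x \<in> moment_fiber 5 v" and y: "y \<in> moment_fiber 5 v"
    and sum: "node_sum x = node_sum y"
  shows "y = x \<or> y = exchange x"
proof -
  have v: "v 0 = 1"
    using nd by (simp add: nondegenerate_def)
  have same: "y = z" if z: "z \<in> moment_fiber 5 v" and "z = (a, b, A, B, l)" "y = (a, b, A', B', l')"
    for z a b A B l A' B' l'
  proof -
    have "(A, B, l) = (A', B', l')"
    proof (rule moments_determine_components[of a b])
      show "a \<noteq> b" "l \<noteq> 0" "l \<noteq> 1"
        using fiber_components_nondegenerate[OF nd] z that(2) by blast+
      show "moment (a, b, A, B, l) i = moment (a, b, A', B', l') i" if "i \<le> 3" for i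
        using z y that \<open>z = _\<close> \<open>y = _\<close> by (simp add: moment_fiber_def del: moment.simps)
    qed
    then show ?thesis
      using that by simp
  qed
  obtain a b A B l where x_eq: "x = (a, b, A, B, l)"
    by (cases x)
  obtain a' b' A' B' l' where y_eq: "y = (a', b', A', B', l')"
    by (cases y)
  have s: "a' + b' = a + b"
    using sum by (simp add: x_eq y_eq)
  note ex = fiber_elimination[OF v x[unfolded x_eq]]
  note ey = fiber_elimination[OF v y[unfolded y_eq]]
  have "poly (lin_den v) (a + b) * (a * b) = poly (lin_den v) (a + b) * (a' * b')"
    using ex(1) ey(1) s by simp
  then have p: "a' * b' = a * b"
    using nondegenerate_root(1)[OF nd ex(2,1)] by simp
  have "(a' - a) * (a' - b) = a' * (a' + b') - (a + b) * a' + (a * b - a' * b')"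
    by (simp add: algebra_simps)
  also have "\<dots> = 0"
    by (simp add: s p mult.commute)
  finally have "a' = a \<or> a' = b"
    by simp
  then show ?thesis
  proof
    assume "a' = a"
    with s have "b' = b"
      by simp
    then show ?thesis
      using same[OF x x_eq] y_eq \<open>a' = a\<close> by blast
  next
    assume "a' = b"
    with s have "b' = a"
      by simp
    have "exchange x = (b, a, B, A, 1 - l)"
      by (simp add: x_eq)
    then show ?thesis
      using same[OF exchange_in_moment_fiber[OF x]] y_eq \<open>a' = b\<close> \<open>b' = a\<close> by blast
  qed
qed

text \<open>
  A root of the eliminant gives a common point \<open>(e, f)\<close> of the two conics. Its nodes are the
  roots of \<open>x\<^sup>2 - e x + f\<close>; the components are chosen to match the moments up to the third, and the
  recurrence then forces the fourth and the fifth to match as well.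
\<close>

lemma fiber_node_sum_surj:
  fixes v :: "nat \<Rightarrow> 'a::{alg_closed_field, field_char_0}"
  assumes nd: "nondegenerate v" and root: "poly (eliminant v) e = 0"
  shows "\<exists>x\<in>moment_fiber 5 v. node_sum x = e"
proof -
  have v: "v 0 = 1"
    using nd by (simp add: nondegenerate_def)
  have den: "poly (lin_den v) e \<noteq> 0"
    using nd root by (auto simp: nondegenerate_def degeneracy_def)
  define f where "f = poly (lin_num v) e / poly (lin_den v) e"
  have lin: "poly (lin_den v) e * f = poly (lin_num v) e"
    using den by (simp add: f_def)
  note nz = nondegenerate_root[OF nd root lin]
  obtain s where s: "s ^ 2 = e\<^sup>2 - 4 * f"
    using nth_root_exists[of 2 "e\<^sup>2 - 4 * f"] by auto
  define a b where "a = (e + s) / 2" and "b = (e - s) / 2"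
  have ab: "a + b = e" "a - b = s"
    by (simp_all add: a_def b_def field_simps)
  have "4 * (a * b) = (a + b)\<^sup>2 - (a - b)\<^sup>2"
    by (simp add: power2_eq_square algebra_simps)
  also have "\<dots> = 4 * f"
    by (simp add: ab s)
  finally have f: "a * b = f"
    by simp
  have "a \<noteq> b"
    using nz(2) ab(2) s by auto
  moreover have "(a - b) ^ 6 \<noteq> 4 * (half_weight v (a + b) (a * b))\<^sup>2"
    using nz(3) unfolding ab f s[symmetric] by (simp flip: power_mult)
  ultimately obtain A B l where low: "\<And>i. i \<le> 3 \<Longrightarrow> moment (a, b, A, B, l) i = v i"
    using components_exist[where v = v and a = a and b = b] v by blast
  let ?m = "moment (a, b, A, B, l)"
  have c: "conic 0 v e f = 0"
    using eliminant_conic[OF v lin] root den by simp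
  then have c': "conic 1 v e f = 0"
    using lin_den_conics[of v e f, OF v] lin by simp
  have m: "conic k ?m e f = 0" for k
    using conic_moment[of k a b A B l] by (simp only: ab f)
  have eq4: "?m 4 = v 4"
    using conic_determines[of 0 ?m e f v] m c low by (simp del: moment.simps)
  have "?m i = v i" if "i < 5" for i
    using low[of i] eq4 that by (cases "i = 4") (simp_all del: moment.simps)
  then have eq5: "?m 5 = v 5"
    using conic_determines[of 1 ?m e f v] m c' by (simp del: moment.simps)
  have "?m i = v i" if "i \<le> 5" for i
  proof -
    have "i \<le> 3 \<or> i = 4 \<or> i = 5"
      using that by auto
    then show ?thesis
      using low eq4 eq5 by blast
  qed
  then have "(a, b, A, B, l) \<in> moment_fiber 5 v"
    by (simp add: moment_fiber_def)
  then show ?thesis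
    using ab(1) by (intro bexI[of _ "(a, b, A, B, l)"]) simp_all
qed

lemma node_sum_fiber:
  fixes v :: "nat \<Rightarrow> 'a::{alg_closed_field, field_char_0}"
  assumes "nondegenerate v"
  shows "node_sum ` moment_fiber 5 v = {e. poly (eliminant v) e = 0}"
proof
  show "node_sum ` moment_fiber 5 v \<subseteq> {e. poly (eliminant v) e = 0}"
  proof clarify
    fix a b A B l assume "(a, b, A, B, l) \<in> moment_fiber 5 v"
    then show "poly (eliminant v) (node_sum (a, b, A, B, l)) = 0"
      using fiber_elimination(2) assms unfolding nondegenerate_def node_sum.simps by blast
  qed
  show "{e. poly (eliminant v) e = 0} \<subseteq> node_sum ` moment_fiber 5 v"
    using fiber_node_sum_surj[OF assms] by blast
qed

text \<open>
  Orbits in the fiber correspond to roots of the eliminant, which are four by simplicity.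
  Two conics meet in four points by Bezout's theorem; the eliminant makes this count elementary.
\<close>

lemma card_exchange_orbits_fiber:
  fixes v :: "nat \<Rightarrow> 'a::{alg_closed_field, field_char_0}"
  assumes nd: "nondegenerate v"
  shows "finite (exchange_orbits (moment_fiber 5 v))"
    and "card (exchange_orbits (moment_fiber 5 v)) = 4"
proof -
  let ?F = "moment_fiber 5 v" and ?R = "{e. poly (eliminant v) e = 0}"
  have lead: "coeff (eliminant v) 4 \<noteq> 0"
    using nd by (simp add: nondegenerate_def)
  then have nz: "eliminant v \<noteq> 0"
    by auto
  have "poly (pderiv (eliminant v)) e \<noteq> 0" if "poly (eliminant v) e = 0" for e
    using nd that by (auto simp: nondegenerate_def degeneracy_def)
  then have "card ?R = Polynomial.degree (eliminant v)"
    using nz by (rule card_roots_eq_degree)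
  also have "\<dots> = 4"
    using lead degree_eliminant[of v] le_degree[of "eliminant v" 4] by simp
  finally have card: "card ?R = 4" .
  define orbit where "orbit e = (let x = inv_into ?F node_sum e in {x, exchange x})" for e
  have pick: "inv_into ?F node_sum e \<in> ?F" "node_sum (inv_into ?F node_sum e) = e"
    if "e \<in> ?R" for e
    using that inv_into_into[of e node_sum ?F] f_inv_into_f[of e node_sum ?F]
    unfolding node_sum_fiber[OF nd] by blast+
  have "exchange_orbits ?F = orbit ` ?R"
  proof
    show "exchange_orbits ?F \<subseteq> orbit ` ?R"
    proof
      fix Q assume "Q \<in> exchange_orbits ?F"
      then obtain x where Q: "Q = {x, exchange x}" and x: "x \<in> ?F"
        unfolding exchange_orbits_def by blast
      then have e: "node_sum x \<in> ?R"
        using node_sum_fiber[OF nd] by blast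
      obtain y where y: "inv_into ?F node_sum (node_sum x) = y"
        by blast
      have "x = y \<or> x = exchange y"
        using fiber_node_sum_inj[OF nd pick(1)[OF e] x pick(2)[OF e]] unfolding y .
      then have "{x, exchange x} = {y, exchange y}"
        by (auto simp: exchange_exchange)
      then have "Q = orbit (node_sum x)"
        unfolding Q orbit_def Let_def y .
      with e show "Q \<in> orbit ` ?R"
        by blast
    qed
    show "orbit ` ?R \<subseteq> exchange_orbits ?F"
      unfolding exchange_orbits_def orbit_def Let_def using pick(1) by blast
  qed
  moreover have "inj_on orbit ?R"
  proof (rule inj_onI)
    fix e e' assume "e \<in> ?R" "e' \<in> ?R" "orbit e = orbit e'"
    moreover have "node_sum ` orbit e = {e}" if "e \<in> ?R" for e
      using pick(2)[OF that] by (simp add: orbit_def Let_def node_sum_exchange)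
    ultimately show "e = e'"
      by (metis singleton_inject)
  qed
  moreover have "finite ?R"
    using card by (simp add: card_ge_0_finite)
  ultimately show "finite (exchange_orbits ?F)" "card (exchange_orbits ?F) = 4"
    using card by (simp_all add: card_image)
qed

lemma finite_moment_fiber:
  fixes v :: "nat \<Rightarrow> 'a::{alg_closed_field, field_char_0}"
  assumes "nondegenerate v"
  shows "finite (moment_fiber 5 v)"
proof (rule finite_subset)
  show "moment_fiber 5 v \<subseteq> \<Union> (exchange_orbits (moment_fiber 5 v))"
    unfolding exchange_orbits_def by blast
  show "finite (\<Union> (exchange_orbits (moment_fiber 5 v)))"
    using card_exchange_orbits_fiber(1)[OF assms] by (auto simp: exchange_orbits_def)
qed

section \<open>The sixth moment\<close>

text \<open>
  With the sixth moment there are three conics. They are linear in \<open>e\<^sup>2 + 2 f\<close>, \<open>- 2 e f\<close>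
  and \<open>f\<^sup>2\<close>, with coefficient matrix the Hankel matrix of \<open>v\<^sub>0 = 1, v\<^sub>1, \<dots>, v\<^sub>4\<close>, and Cramer's
  rule expresses these three unknowns as affine functions of \<open>e\<close> (up to the determinant).
\<close>

definition hankel_det :: "(nat \<Rightarrow> 'a::field) \<Rightarrow> 'a" where
  "hankel_det v = v 2 * ((v 2)\<^sup>2 - v 1 * v 3) + v 3 * (v 3 - v 1 * v 2) + v 4 * ((v 1)\<^sup>2 - v 2)"

text \<open>
  An entry of the adjugate of the Hankel matrix times the vector \<open>(r, s, t)\<close>, where \<open>j\<close> is the
  exponent of \<open>x\<close> in \<open>(x\<^sup>2 - e x + f)\<^sup>2\<close> that the unknown is the coefficient of.
\<close>

definition cofactor_sum :: "nat \<Rightarrow> (nat \<Rightarrow> 'a::field) \<Rightarrow> 'a \<Rightarrow> 'a \<Rightarrow> 'a \<Rightarrow> 'a" where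
  "cofactor_sum j v r s t =
     (if j = 0 then (v 3 * v 3 - v 2 * v 4) * r + (v 1 * v 4 - v 2 * v 3) * s + ((v 2)\<^sup>2 - v 1 * v 3) * t
      else if j = 1 then (v 1 * v 4 - v 2 * v 3) * r + ((v 2)\<^sup>2 - v 4) * s + (v 3 - v 1 * v 2) * t
      else ((v 2)\<^sup>2 - v 1 * v 3) * r + (v 3 - v 1 * v 2) * s + ((v 1)\<^sup>2 - v 2) * t)"

definition cramer_const :: "nat \<Rightarrow> (nat \<Rightarrow> 'a::field) \<Rightarrow> 'a" where
  "cramer_const j v = cofactor_sum j v (- v 4) (- v 5) (- v 6)"

definition cramer_slope :: "nat \<Rightarrow> (nat \<Rightarrow> 'a::field) \<Rightarrow> 'a" where
  "cramer_slope j v = cofactor_sum j v (2 * v 3) (2 * v 4) (2 * v 5)"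

lemma cramer:
  fixes v :: "nat \<Rightarrow> 'a::field"
  assumes v0: "v 0 = 1" and c: "conic 0 v e f = 0" "conic 1 v e f = 0" "conic 2 v e f = 0"
  shows "hankel_det v * (e\<^sup>2 + 2 * f) = cramer_const 2 v + cramer_slope 2 v * e"
    and "hankel_det v * (- 2 * e * f) = cramer_const 1 v + cramer_slope 1 v * e"
    and "hankel_det v * f\<^sup>2 = cramer_const 0 v + cramer_slope 0 v * e"
proof -
  have "hankel_det v * (e\<^sup>2 + 2 * f) - (cramer_const 2 v + cramer_slope 2 v * e)
      = cofactor_sum 2 v (conic 0 v e f) (conic 1 v e f) (conic 2 v e f)"
    using v0 by (simp add: hankel_det_def cramer_const_def cramer_slope_def cofactor_sum_def
        conic_def numeral_eq_Suc algebra_simps)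
  then show "hankel_det v * (e\<^sup>2 + 2 * f) = cramer_const 2 v + cramer_slope 2 v * e"
    using c by (simp add: cofactor_sum_def)
  have "hankel_det v * (- 2 * e * f) - (cramer_const 1 v + cramer_slope 1 v * e)
      = cofactor_sum 1 v (conic 0 v e f) (conic 1 v e f) (conic 2 v e f)"
    using v0 by (simp add: hankel_det_def cramer_const_def cramer_slope_def cofactor_sum_def
        conic_def numeral_eq_Suc algebra_simps)
  then show "hankel_det v * (- 2 * e * f) = cramer_const 1 v + cramer_slope 1 v * e"
    using c by (simp add: cofactor_sum_def)
  have "hankel_det v * f\<^sup>2 - (cramer_const 0 v + cramer_slope 0 v * e)
      = cofactor_sum 0 v (conic 0 v e f) (conic 1 v e f) (conic 2 v e f)"
    using v0 by (simp add: hankel_det_def cramer_const_def cramer_slope_def cofactor_sum_def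
        conic_def numeral_eq_Suc algebra_simps)
  then show "hankel_det v * f\<^sup>2 = cramer_const 0 v + cramer_slope 0 v * e"
    using c by (simp add: cofactor_sum_def)
qed

text \<open>
  Eliminating \<open>f\<close> from the first two Cramer equations gives a cubic in \<open>e\<close>, eliminating it from
  the first and the third a quartic. The quadratic with the coefficients below is the remainder
  of the quartic modulo the cubic.
\<close>

definition quad2 :: "(nat \<Rightarrow> 'a::field) \<Rightarrow> 'a" where
  "quad2 v = hankel_det v * (cramer_slope 1 v - cramer_const 2 v)"

definition quad1 :: "(nat \<Rightarrow> 'a::field) \<Rightarrow> 'a" where
  "quad1 v = hankel_det v * cramer_const 1 v
     + cramer_slope 2 v * (cramer_const 2 v - cramer_slope 1 v) - 4 * hankel_det v * cramer_slope 0 v"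

definition quad0 :: "(nat \<Rightarrow> 'a::field) \<Rightarrow> 'a" where
  "quad0 v = (cramer_const 2 v)\<^sup>2 - 4 * hankel_det v * cramer_const 0 v
     - cramer_slope 2 v * cramer_const 1 v"

text \<open>
  Up to sign, the coefficient of \<open>e\<close> in the pseudo-remainder of the cubic by the quadratic. This
  remainder has degree at most one, so it has at most one root if the coefficient is nonzero.
\<close>

definition separator :: "(nat \<Rightarrow> 'a::field) \<Rightarrow> 'a" where
  "separator v = hankel_det v * quad0 v * quad2 v
     - (cramer_slope 2 v * quad2 v + hankel_det v * quad1 v) * quad1 v
     + (cramer_const 2 v + cramer_slope 1 v) * (quad2 v)\<^sup>2"

lemma node_sum_equations:
  fixes v :: "nat \<Rightarrow> 'a::field"
  assumes v0: "v 0 = 1" and c: "conic 0 v e f = 0" "conic 1 v e f = 0" "conic 2 v e f = 0"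
  shows "hankel_det v * e ^ 3 - cramer_slope 2 v * e\<^sup>2
      - (cramer_const 2 v + cramer_slope 1 v) * e - cramer_const 1 v = 0" (is ?cubic)
    and "quad2 v * e\<^sup>2 + quad1 v * e + quad0 v = 0"
proof -
  note cr = cramer[OF v0 c]
  define D p2 r2 p1 r1 p0 r0 where defs: "D = hankel_det v"
    "p2 = cramer_const 2 v" "r2 = cramer_slope 2 v" "p1 = cramer_const 1 v" "r1 = cramer_slope 1 v"
    "p0 = cramer_const 0 v" "r0 = cramer_slope 0 v"
  note cr = cr[folded defs]
  have cubic: "D * e ^ 3 - r2 * e\<^sup>2 - (p2 + r1) * e - p1 = 0"
  proof -
    have "D * e ^ 3 = e * (D * (e\<^sup>2 + 2 * f)) + D * (- 2 * e * f)"
      by (simp add: power2_eq_square power3_eq_cube algebra_simps)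
    then show ?thesis
      unfolding cr by (simp add: power2_eq_square algebra_simps)
  qed
  then show ?cubic
    by (simp only: defs)
  have "D * (r1 - p2) * e\<^sup>2 + (D * p1 + r2 * (p2 - r1) - 4 * D * r0) * e + (p2\<^sup>2 - 4 * D * p0 - r2 * p1) = 0"
  proof -
    have "p2 + r2 * e - D * e\<^sup>2 = 2 * D * f"
      using cr(1) by (simp add: algebra_simps)
    then have quartic: "(p2 + r2 * e - D * e\<^sup>2)\<^sup>2 - 4 * D * (p0 + r0 * e) = 0"
      unfolding cr(3)[symmetric] by (simp add: power2_eq_square algebra_simps)
    \<comment> \<open>division of the quartic by the cubic, with quotient \<open>D e - r2\<close>\<close>
    have "D * (r1 - p2) * e\<^sup>2 + (D * p1 + r2 * (p2 - r1) - 4 * D * r0) * e + (p2\<^sup>2 - 4 * D * p0 - r2 * p1)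
        = ((p2 + r2 * e - D * e\<^sup>2)\<^sup>2 - 4 * D * (p0 + r0 * e))
          - (D * e - r2) * (D * e ^ 3 - r2 * e\<^sup>2 - (p2 + r1) * e - p1)"
      by (simp add: power2_eq_square power3_eq_cube algebra_simps)
    then show ?thesis
      by (simp add: quartic cubic)
  qed
  then show "quad2 v * e\<^sup>2 + quad1 v * e + quad0 v = 0"
    by (simp only: defs quad2_def quad1_def quad0_def)
qed

lemma common_root_of_cubic_and_quadratic_unique:
  fixes e e' :: "'a::field"
  assumes "D * e ^ 3 - r * e\<^sup>2 - s * e - p = 0" "D * e' ^ 3 - r * e'\<^sup>2 - s * e' - p = 0"
    and "a * e\<^sup>2 + b * e + c = 0" "a * e'\<^sup>2 + b * e' + c = 0"
    and ne: "D * c * a - (r * a + D * b) * b + s * a\<^sup>2 \<noteq> 0"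
  shows "e = e'"
proof (rule ccontr)
  assume "e \<noteq> e'"
  then have d: "e - e' \<noteq> 0"
    by simp
  have "(e - e') * (a * (e + e') + b) = (a * e\<^sup>2 + b * e + c) - (a * e'\<^sup>2 + b * e' + c)"
    by (simp add: power2_eq_square algebra_simps)
  with d assms(3,4) have "a * (e + e') + b = 0"
    by simp
  then have b: "b = - (a * (e + e'))"
    by (simp add: add_eq_0_iff)
  have "c = - (a * e\<^sup>2 + b * e)"
    using assms(3) by (simp add: add_eq_0_iff)
  then have c: "c = a * e * e'"
    unfolding b by (simp add: power2_eq_square algebra_simps)
  have "(e - e') * (D * (e\<^sup>2 + e * e' + e'\<^sup>2) - r * (e + e') - s)
      = (D * e ^ 3 - r * e\<^sup>2 - s * e - p) - (D * e' ^ 3 - r * e'\<^sup>2 - s * e' - p)"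
    by (simp add: power2_eq_square power3_eq_cube algebra_simps)
  with d assms(1,2) have s: "s = D * (e\<^sup>2 + e * e' + e'\<^sup>2) - r * (e + e')"
    by simp
  have "D * c * a - (r * a + D * b) * b + s * a\<^sup>2 = 0"
    unfolding b c s by (simp add: power2_eq_square algebra_simps)
  with ne show False ..
qed

lemma fiber6_node_sum_eq:
  fixes v :: "nat \<Rightarrow> 'a::field"
  assumes v0: "v 0 = 1" and sep: "separator v \<noteq> 0"
    and x: "x \<in> moment_fiber 6 v" and y: "y \<in> moment_fiber 6 v"
  shows "node_sum x = node_sum y"
proof -
  have eqs: "hankel_det v * node_sum z ^ 3 - cramer_slope 2 v * (node_sum z)\<^sup>2
      - (cramer_const 2 v + cramer_slope 1 v) * node_sum z - cramer_const 1 v = 0"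
    "quad2 v * (node_sum z)\<^sup>2 + quad1 v * node_sum z + quad0 v = 0"
    if z: "z \<in> moment_fiber 6 v" for z
  proof -
    obtain a b A B l where "z = (a, b, A, B, l)"
      by (cases z)
    note z' = z[unfolded this]
    have c: "conic 0 v (a + b) (a * b) = 0" "conic 1 v (a + b) (a * b) = 0"
      "conic 2 v (a + b) (a * b) = 0"
      by (rule fiber_conic[OF z'], simp)+
    show "hankel_det v * node_sum z ^ 3 - cramer_slope 2 v * (node_sum z)\<^sup>2
        - (cramer_const 2 v + cramer_slope 1 v) * node_sum z - cramer_const 1 v = 0"
      "quad2 v * (node_sum z)\<^sup>2 + quad1 v * node_sum z + quad0 v = 0"
      using node_sum_equations[OF v0 c] by (simp_all add: \<open>z = _\<close>)
  qed
  show ?thesis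
    by (rule common_root_of_cubic_and_quadratic_unique[OF eqs(1)[OF x] eqs(1)[OF y] eqs(2)[OF x] eqs(2)[OF y]])
      (use sep in \<open>simp add: separator_def\<close>)
qed

lemma exchange_orbits_fiber6:
  fixes v :: "nat \<Rightarrow> 'a::field_char_0"
  assumes nd: "nondegenerate v" and sep: "separator v \<noteq> 0" and x: "x \<in> moment_fiber 6 v"
  shows "exchange_orbits (moment_fiber 6 v) = {{x, exchange x}}"
proof -
  have v0: "v 0 = 1"
    using nd by (simp add: nondegenerate_def)
  have sub: "moment_fiber 6 v \<subseteq> moment_fiber 5 v"
    by (auto simp: moment_fiber_def)
  have "y = x \<or> y = exchange x" if y: "y \<in> moment_fiber 6 v" for y
    using fiber_node_sum_inj[OF nd] sub x y fiber6_node_sum_eq[OF v0 sep x y] by blast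
  then have orbit: "{y, exchange y} = {x, exchange x}" if "y \<in> moment_fiber 6 v" for y
    using that by (fastforce simp: exchange_exchange)
  have "exchange_orbits (moment_fiber 6 v) = (\<lambda>_. {x, exchange x}) ` moment_fiber 6 v"
    unfolding exchange_orbits_def by (rule image_cong[OF refl orbit])
  also have "\<dots> = {{x, exchange x}}"
    using x by (rule image_constant)
  finally show ?thesis .
qed

section \<open>Genericity\<close>

lemma regular_poly_degeneracy:
  assumes "5 \<le> d"
  shows "regular_poly d 16 (degeneracy :: (nat \<Rightarrow> 'a::field_char_0) \<Rightarrow> 'a poly)"
proof -
  have disc: "regular_poly d 3 (discriminant_num :: (nat \<Rightarrow> 'a) \<Rightarrow> 'a poly)"
    unfolding discriminant_num_def[abs_def] using assms
    by - (rule regular_poly_mono, (rule regular_poly_lin_den regular_poly_lin_num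
        regular_poly_intros regular_intros | simp)+)
  have weight: "regular_poly d 4 (weight_num :: (nat \<Rightarrow> 'a) \<Rightarrow> 'a poly)"
    unfolding weight_num_def[abs_def] using assms
    by - (rule regular_poly_mono, (rule disc regular_poly_lin_den
        regular_poly_intros regular_intros | simp)+)
  show ?thesis
    unfolding degeneracy_def[abs_def] using assms
    by - (rule regular_poly_mono, (rule disc weight regular_poly_lin_den regular_poly_eliminant
        regular_poly_intros regular_intros | simp)+)
qed

definition nondegeneracy_form :: "(nat \<Rightarrow> 'a::field) \<Rightarrow> 'a" where
  "nondegeneracy_form v = coeff (eliminant v) 4 * sylvester_det 4 16 (eliminant v) (degeneracy v)"

lemma regular_nondegeneracy_form:
  assumes "5 \<le> d"
  shows "regular d (nondegeneracy_form :: (nat \<Rightarrow> 'a::field_char_0) \<Rightarrow> 'a)"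
proof -
  have elim: "regular_poly d 4 (eliminant :: (nat \<Rightarrow> 'a) \<Rightarrow> 'a poly)"
    using assms by (rule regular_poly_eliminant)
  then have "regular d (\<lambda>v :: nat \<Rightarrow> 'a. coeff (eliminant v) 4)"
    by (simp add: regular_poly_def)
  moreover have "regular d (\<lambda>v :: nat \<Rightarrow> 'a. sylvester_det 4 16 (eliminant v) (degeneracy v))"
    using elim regular_poly_degeneracy[OF assms] by (rule regular_sylvester_det)
  ultimately show ?thesis
    unfolding nondegeneracy_form_def[abs_def] by (rule regular_mult)
qed

lemma degree_degeneracy: "Polynomial.degree (degeneracy (v :: nat \<Rightarrow> 'a::field_char_0)) \<le> 16"
  using regular_poly_degeneracy[of 5] unfolding regular_poly_def by blast

lemma nondegenerate_if_form:
  fixes v :: "nat \<Rightarrow> 'a::field_char_0"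
  assumes "v 0 = 1" "nondegeneracy_form v \<noteq> 0"
  shows "nondegenerate v"
  using assms sylvester_det_eq_0[of "eliminant v" _ "degeneracy v" 4 16]
    degree_eliminant[of v] degree_degeneracy[of v]
  by (auto simp: nondegenerate_def nondegeneracy_form_def)

lemma regular_separator: "regular 6 separator"
  unfolding separator_def[abs_def] quad2_def quad1_def quad0_def cramer_const_def cramer_slope_def
    cofactor_sum_def hankel_det_def
  by (simp, (rule regular_intros | simp)+)

text \<open>
  Chosen so that the eliminant splits over the rationals (its roots are \<open>3, 6, -6, -50/9\<close>), which
  reduces the nonvanishing of the Sylvester determinant to the evaluation of polynomials at four numbers.
\<close>

definition witness :: "'a::field_char_0 params" where
  "witness = (6, 0, - 4 / 3, 2, 1 / 4)"

lemma witness_moments: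
  "moment witness (Suc 0) = 8 / 3" "moment witness 2 = 5" "moment witness 3 = 18"
  "moment witness 4 = 36" "moment witness 5 = - 216" "moment witness 6 = - 3888"
  by (simp_all add: witness_def)

lemma witness_separator: "separator (moment_vector 6 witness) \<noteq> 0"
  by (simp add: separator_def quad2_def quad1_def quad0_def cramer_const_def cramer_slope_def
      cofactor_sum_def hankel_det_def moment_vector_def witness_moments power2_eq_square)

lemma witness_nondegeneracy_form:
  assumes "5 \<le> d"
  shows "nondegeneracy_form (moment_vector d witness :: nat \<Rightarrow> 'a::field_char_0) \<noteq> 0"
proof -
  let ?v = "moment_vector d witness :: nat \<Rightarrow> 'a"
  have v: "?v (Suc 0) = 8 / 3" "?v 2 = 5" "?v 3 = 18" "?v 4 = 36" "?v 5 = - 216"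
    using assms by (simp_all add: moment_vector_def witness_moments)
  have den: "lin_den ?v = [:28 / 3, 38 / 9:]"
    by (simp add: lin_den_def v power2_eq_square)
  have num: "lin_num ?v = [:312, - 24, - 14 / 3:]"
    by (simp add: lin_num_def v)
  have elim: "eliminant ?v = [:129600, - 19872, - 11376, 552, 216:]"
    by (simp add: eliminant_def den num v power2_eq_square)
  have disc: "discriminant_num ?v = [:- 1248, 96, 28, 38 / 9:]"
    by (simp add: discriminant_num_def den num)
  have weight: "weight_num ?v = [:- 5328, 1308, 66, - 56 / 3, - 19 / 9:]"
    by (simp add: weight_num_def den disc v)
  have neg_fraction: "- (r / s) = t \<longleftrightarrow> r + t * s = 0" if "s \<noteq> 0" for r s t :: 'a
    using that by (auto simp: field_simps add_eq_0_iff)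
  let ?R = "{3, 6, - 6, - 50 / 9} :: 'a set"
  have "sylvester_det 4 16 (eliminant ?v) (degeneracy ?v) \<noteq> 0"
  proof (rule sylvester_det_neq_0)
    show "eliminant ?v \<noteq> 0"
      by (simp add: elim)
    show "card ?R = 4"
      by (simp add: eq_commute[of _ "- (50 / 9)"] neg_fraction)
    show "poly (eliminant ?v) e = 0" if "e \<in> ?R" for e
      using that by (auto simp: elim)
    show "poly (degeneracy ?v) e \<noteq> 0" if "e \<in> ?R" for e
      using that unfolding degeneracy_def poly_mult poly_diff poly_power poly_smult
        elim den disc weight
      by (auto simp: pderiv_pCons power2_eq_square power3_eq_cube neg_fraction)
  qed (rule degree_eliminant degree_degeneracy)+
  then show ?thesis
    by (simp add: nondegeneracy_form_def elim coeff_pCons numeral_eq_Suc)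
qed

lemma vimage_moment_map:
  "moment_map d -` {moment_map d x} = moment_fiber d (moment_vector d x)"
  by (auto simp: moment_map_eq_iff moment_fiber_def moment_vector_def)

theorem mainTheorem3:
  shows "generically_to_one_up_to_exchange 5
           (moment_map 5 :: 'a::{alg_closed_field, field_char_0} params \<Rightarrow> 'a proj_point) 4
       \<and> generically_finite_to_one 5 (moment_map 5 :: 'a params \<Rightarrow> 'a proj_point)
       \<and> generically_to_one_up_to_exchange 6 (moment_map 6 :: 'a params \<Rightarrow> 'a proj_point) 1"
proof (intro conjI)
  show "generically_to_one_up_to_exchange 5 (moment_map 5 :: 'a params \<Rightarrow> 'a proj_point) 4"
    unfolding generically_to_one_up_to_exchange_def
  proof (rule generically_on_range_moment_map)
    show "regular 5 (nondegeneracy_form :: (nat \<Rightarrow> 'a) \<Rightarrow> 'a)"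
      by (rule regular_nondegeneracy_form) simp
    show "nondegeneracy_form (moment_vector 5 (witness :: 'a params)) \<noteq> 0"
      by (rule witness_nondegeneracy_form) simp
    fix x :: "'a params"
    assume "nondegeneracy_form (moment_vector 5 x) \<noteq> 0"
    then show "finite (exchange_orbits (moment_map 5 -` {moment_map 5 x})) \<and>
        card (exchange_orbits (moment_map 5 -` {moment_map 5 x})) = 4"
      unfolding vimage_moment_map
      using card_exchange_orbits_fiber nondegenerate_if_form moment_vector_0 by blast
  qed
  show "generically_finite_to_one 5 (moment_map 5 :: 'a params \<Rightarrow> 'a proj_point)"
    unfolding generically_finite_to_one_def
  proof (rule generically_on_range_moment_map)
    show "regular 5 (nondegeneracy_form :: (nat \<Rightarrow> 'a) \<Rightarrow> 'a)"
      by (rule regular_nondegeneracy_form) simp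
    show "nondegeneracy_form (moment_vector 5 (witness :: 'a params)) \<noteq> 0"
      by (rule witness_nondegeneracy_form) simp
    fix x :: "'a params"
    assume "nondegeneracy_form (moment_vector 5 x) \<noteq> 0"
    then show "finite (moment_map 5 -` {moment_map 5 x})"
      unfolding vimage_moment_map
      using finite_moment_fiber nondegenerate_if_form moment_vector_0 by blast
  qed
  show "generically_to_one_up_to_exchange 6 (moment_map 6 :: 'a params \<Rightarrow> 'a proj_point) 1"
    unfolding generically_to_one_up_to_exchange_def
  proof (rule generically_on_range_moment_map)
    let ?\<phi> = "\<lambda>v :: nat \<Rightarrow> 'a. nondegeneracy_form v * separator v"
    show "regular 6 ?\<phi>"
      by (intro regular_mult regular_nondegeneracy_form regular_separator) simp
    show "?\<phi> (moment_vector 6 witness) \<noteq> 0"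
      using witness_nondegeneracy_form[of 6] witness_separator by simp
    fix x :: "'a params"
    let ?v = "moment_vector 6 x"
    assume "?\<phi> ?v \<noteq> 0"
    then have "nondegenerate ?v" "separator ?v \<noteq> 0"
      by (simp_all add: nondegenerate_if_form)
    moreover have "x \<in> moment_fiber 6 ?v"
      by (simp add: moment_fiber_def moment_vector_def)
    ultimately have "exchange_orbits (moment_fiber 6 ?v) = {{x, exchange x}}"
      by (rule exchange_orbits_fiber6)
    then show "finite (exchange_orbits (moment_map 6 -` {moment_map 6 x})) \<and>
        card (exchange_orbits (moment_map 6 -` {moment_map 6 x})) = 1"
      unfolding vimage_moment_map by simp
  qed
qed

end
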